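(* Let $G$ and $H$ be finitely generated groups and let $G_*$ and $H_*$ be context-free subgroups of $G$ and $H$ respectively. Let $$G \wr_{H_*} H = \Big(\bigoplus_{H_* \backslash H} G\Big) \rtimes H$$ denote the generalised wreath product. Then $$\Big(\Big(\bigoplus_{H_* \backslash (H - H_* )} G \Big)\oplus G_*\Big) \rtimes H_*$$ is a context-free subgroup of $G \wr_{H_*} H$. (Here $H_*\backslash(H-H_* )$ is the set of right cosets $H_*h$ with $h\notin H_*$, and the summand $G_*$ sits in the copy of $G$ indexed by the coset $H_*$; i.e. the subgroup consists of the products of $\bigoplus_{H_*\backslash H} g_h$ and $h_*$ with $h_*\in H_*$ and with component at the trivial coset $H_*$ lying in $G_*$.)
   Context: Generalised wreath product: $H_*\backslash H$ is the set of right cosets $H_*h$. Elements of $\bigoplus_{H_*\backslash H}G$ are finitely supported families $\bigoplus_{H_*\backslash H} g_h$ with $g_h\in G$ indexed by the cosets $H_*h$ ($h$ ranging over coset representatives, $g_h$ depending only on $H_*h$). $H$ acts by conjugation in the semidirect product by $$\widetilde h^{-1}\Big(\bigoplus_{H_*\backslash H} g_h\Big)\widetilde h=\bigoplus_{H_*\backslash H} g_{h\widetilde h^{-1}}\qquad(\widetilde h\in H),$$ i.e. the component of the right side at $H_*h$ is the component of the original family at $H_*h\widetilde h^{-1}$. Context-free subgroups: a symmetric alphabet is a finite set $\Sigma$ with an involution $s\mapsto\overline s$, extended to the free monoid $\Sigma^*$ by $\overline{s_1\cdots s_n}=\overline{s_n}\cdots\overline{s_1}$. A monoid homomorphism $\rho:\Sigma^*\to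 K$ to a group $K$ is symmetric if $\rho(\overline\sigma)=\rho(\sigma)^{-1}$ for all $\sigma\in\Sigma^*$. The membership problem of a subgroup $K_*$ in $K$ with respect to a symmetric surjective homomorphism $\rho:\Sigma^*\to K$ is the language $\rho^{-1}(K_* )\subset\Sigma^*$. The subgroup $K_*$ is a context-free subgroup of the finitely generated group $K$ if this language is context-free (in the usual sense: accepted by a pushdown automaton, equivalently generated by a context-free grammar); this does not depend on the choice of $\Sigma$ and $\rho$. *)

theory Defs
  imports "HOL-Algebra.Algebra"
begin

section \<open>Context-free languages\<close>

datatype 'a symbol = Nonterminal nat | Terminal 'a

text \<open>A production \<open>(A, \<alpha>)\<close> stands for \<open>A \<rightarrow> \<alpha>\<close>; the right-hand side may be empty.\<close>

type_synonym 'a productions = "(nat \<times> 'a symbol list) set"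

inductive derives_step :: "'a productions \<Rightarrow> 'a symbol list \<Rightarrow> 'a symbol list \<Rightarrow> bool"
  for P where
  "(A, \<alpha>) \<in> P \<Longrightarrow> derives_step P (u @ [Nonterminal A] @ v) (u @ \<alpha> @ v)"

definition grammar_language :: "'a productions \<Rightarrow> nat \<Rightarrow> 'a list set" where
  "grammar_language P S = {w. (derives_step P)\<^sup>*\<^sup>* [Nonterminal S] (map Terminal w)}"

text \<open>Finiteness of the set of productions bounds the nonterminals and terminals in use, so
  there is no loss of generality in drawing the nonterminals from \<^typ>\<open>nat\<close>.\<close>

definition context_free_language :: "'a list set \<Rightarrow> bool" where
  "context_free_language L \<longleftrightarrow> (\<exists>P S. finite P \<and> L = grammar_language P S)"


section \<open>Context-free subgroups\<close>

definition finitely_generated :: "('a, 'm) monoid_scheme \<Rightarrow> bool" where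
  "finitely_generated K \<longleftrightarrow> (\<exists>B. finite B \<and> B \<subseteq> carrier K \<and> generate K B = carrier K)"

definition symmetric_alphabet :: "'s set \<Rightarrow> ('s \<Rightarrow> 's) \<Rightarrow> bool" where
  "symmetric_alphabet \<Sigma> bar \<longleftrightarrow> finite \<Sigma> \<and> (\<forall>s\<in>\<Sigma>. bar s \<in> \<Sigma> \<and> bar (bar s) = s)"

definition word_bar :: "('s \<Rightarrow> 's) \<Rightarrow> 's list \<Rightarrow> 's list" where
  "word_bar bar w = rev (map bar w)"

definition free_monoid :: "'s set \<Rightarrow> 's list monoid" where
  "free_monoid \<Sigma> = \<lparr>carrier = lists \<Sigma>, monoid.mult = (@), one = []\<rparr>"

definition symmetric_epimorphism ::
  "'s set \<Rightarrow> ('s \<Rightarrow> 's) \<Rightarrow> ('k, 'm) monoid_scheme \<Rightarrow> ('s list \<Rightarrow> 'k) \<Rightarrow> bool" where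
  "symmetric_epimorphism \<Sigma> bar K \<rho> \<longleftrightarrow>
     \<rho> \<in> hom (free_monoid \<Sigma>) K \<and> \<rho> [] = \<one>\<^bsub>K\<^esub> \<and>
     (\<forall>w\<in>lists \<Sigma>. \<rho> (word_bar bar w) = inv\<^bsub>K\<^esub> \<rho> w) \<and>
     \<rho> ` lists \<Sigma> = carrier K"

definition membership_problem :: "'s set \<Rightarrow> ('s list \<Rightarrow> 'k) \<Rightarrow> 'k set \<Rightarrow> 's list set" where
  "membership_problem \<Sigma> \<rho> K' = {w \<in> lists \<Sigma>. \<rho> w \<in> K'}"

text \<open>Whether the membership problem is context-free does not depend on the choice of the
  symmetric alphabet and of the epimorphism, so some choice is asked for; an arbitrary finite
  alphabet can be renamed to a set of natural numbers.\<close>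

definition context_free_subgroup :: "('k, 'm) monoid_scheme \<Rightarrow> 'k set \<Rightarrow> bool" where
  "context_free_subgroup K K' \<longleftrightarrow>
     group K \<and> finitely_generated K \<and> subgroup K' K \<and>
     (\<exists>(\<Sigma> :: nat set) bar \<rho>.
        symmetric_alphabet \<Sigma> bar \<and> symmetric_epimorphism \<Sigma> bar K \<rho> \<and>
        context_free_language (membership_problem \<Sigma> \<rho> K'))"


section \<open>Generalised wreath products\<close>

abbreviation wreath_base ::
  "('g, 'm) monoid_scheme \<Rightarrow> ('h, 'n) monoid_scheme \<Rightarrow> 'h set \<Rightarrow> ('h set \<Rightarrow> 'g) monoid" where
  "wreath_base G H H' \<equiv> sum_group (rcosets\<^bsub>H\<^esub> H') (\<lambda>_. G)"

text \<open>The family \<open>h\<inverse> f h\<close>, whose component at \<open>C\<close> is the component of \<open>f\<close> at \<open>C h\<inverse>\<close>.\<close>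

definition wreath_conj ::
  "('h, 'n) monoid_scheme \<Rightarrow> 'h set \<Rightarrow> 'h \<Rightarrow> ('h set \<Rightarrow> 'g) \<Rightarrow> ('h set \<Rightarrow> 'g)" where
  "wreath_conj H H' h f = (\<lambda>C\<in>rcosets\<^bsub>H\<^esub> H'. f (C #>\<^bsub>H\<^esub> inv\<^bsub>H\<^esub> h))"

text \<open>The pair \<open>(f, h)\<close> stands for the product \<open>f h\<close>, so
  \<open>(f\<^sub>1 h\<^sub>1) (f\<^sub>2 h\<^sub>2) = f\<^sub>1 (h\<^sub>1 f\<^sub>2 h\<^sub>1\<inverse>) (h\<^sub>1 h\<^sub>2)\<close>.\<close>

definition gen_wreath ::
  "('g, 'm) monoid_scheme \<Rightarrow> ('h, 'n) monoid_scheme \<Rightarrow> 'h set \<Rightarrow> (('h set \<Rightarrow> 'g) \<times> 'h) monoid" where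
  "gen_wreath G H H' =
     \<lparr>carrier = carrier (wreath_base G H H') \<times> carrier H,
      monoid.mult = (\<lambda>(f1, h1) (f2, h2).
        (f1 \<otimes>\<^bsub>wreath_base G H H'\<^esub> wreath_conj H H' (inv\<^bsub>H\<^esub> h1) f2, h1 \<otimes>\<^bsub>H\<^esub> h2)),
      one = (\<one>\<^bsub>wreath_base G H H'\<^esub>, \<one>\<^bsub>H\<^esub>)\<rparr>"

text \<open>The trivial coset is \<open>H'\<close> itself; the other components are unconstrained.\<close>

definition gen_wreath_subgroup ::
  "('g, 'm) monoid_scheme \<Rightarrow> 'g set \<Rightarrow> ('h, 'n) monoid_scheme \<Rightarrow> 'h set \<Rightarrow>
     (('h set \<Rightarrow> 'g) \<times> 'h) set" where
  "gen_wreath_subgroup G G' H H' = {f \<in> carrier (wreath_base G H H'). f H' \<in> G'} \<times> H'"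

context
  fixes G :: "('g, 'm) monoid_scheme" and H :: "('h, 'n) monoid_scheme" and H' :: "'h set"
  assumes G: "group G" and H: "group H" and H': "subgroup H' H"
begin

interpretation G: group G by (rule G)
interpretation H: group H by (rule H)

lemma rcoset_mult_closed:
  assumes "C \<in> rcosets\<^bsub>H\<^esub> H'" "h \<in> carrier H"
  shows "C #>\<^bsub>H\<^esub> h \<in> rcosets\<^bsub>H\<^esub> H'"
proof -
  obtain k where k: "k \<in> carrier H" "C = H' #>\<^bsub>H\<^esub> k"
    using assms by (auto simp: RCOSETS_def)
  then have "C #>\<^bsub>H\<^esub> h = H' #>\<^bsub>H\<^esub> (k \<otimes>\<^bsub>H\<^esub> h)"
    using assms subgroup.subset[OF H'] by (simp add: H.coset_mult_assoc)
  then show ?thesis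
    using assms k subgroup.subset[OF H'] by (simp add: H.rcosetsI)
qed

lemma rcoset_mult_assoc:
  assumes "C \<in> rcosets\<^bsub>H\<^esub> H'" "h \<in> carrier H" "k \<in> carrier H"
  shows "(C #>\<^bsub>H\<^esub> h) #>\<^bsub>H\<^esub> k = C #>\<^bsub>H\<^esub> (h \<otimes>\<^bsub>H\<^esub> k)"
  using assms subgroup.rcosets_carrier[OF H' H] by (intro H.coset_mult_assoc)

lemma rcoset_mult_one: "C \<in> rcosets\<^bsub>H\<^esub> H' \<Longrightarrow> C #>\<^bsub>H\<^esub> \<one>\<^bsub>H\<^esub> = C"
  using subgroup.rcosets_carrier[OF H' H] by (intro H.coset_mult_one)

lemma carrier_wreath_base:
  "carrier (wreath_base G H H') =
     {f \<in> rcosets\<^bsub>H\<^esub> H' \<rightarrow>\<^sub>E carrier G. finite {C \<in> rcosets\<^bsub>H\<^esub> H'. f C \<noteq> \<one>\<^bsub>G\<^esub>}}"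
  by (rule carrier_sum_group) (rule G)

lemma wreath_conj_closed:
  assumes f: "f \<in> carrier (wreath_base G H H')" and h: "h \<in> carrier H"
  shows "wreath_conj H H' h f \<in> carrier (wreath_base G H H')"
proof -
  let ?I = "rcosets\<^bsub>H\<^esub> H'"
  have "{C \<in> ?I. f (C #>\<^bsub>H\<^esub> inv\<^bsub>H\<^esub> h) \<noteq> \<one>\<^bsub>G\<^esub>} \<subseteq> (\<lambda>C. C #>\<^bsub>H\<^esub> h) ` {C \<in> ?I. f C \<noteq> \<one>\<^bsub>G\<^esub>}"
  proof
    fix C assume C: "C \<in> {C \<in> ?I. f (C #>\<^bsub>H\<^esub> inv\<^bsub>H\<^esub> h) \<noteq> \<one>\<^bsub>G\<^esub>}"
    then have "C = (C #>\<^bsub>H\<^esub> inv\<^bsub>H\<^esub> h) #>\<^bsub>H\<^esub> h"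
      using h by (simp add: rcoset_mult_assoc rcoset_mult_one)
    then show "C \<in> (\<lambda>C. C #>\<^bsub>H\<^esub> h) ` {C \<in> ?I. f C \<noteq> \<one>\<^bsub>G\<^esub>}"
      using C h by (intro image_eqI[of _ _ "C #>\<^bsub>H\<^esub> inv\<^bsub>H\<^esub> h"]) (simp_all add: rcoset_mult_closed)
  qed
  then have "finite {C \<in> ?I. f (C #>\<^bsub>H\<^esub> inv\<^bsub>H\<^esub> h) \<noteq> \<one>\<^bsub>G\<^esub>}"
    using f by (auto simp: carrier_wreath_base intro: finite_subset)
  then show ?thesis
    using f h by (auto simp: carrier_wreath_base wreath_conj_def PiE_iff rcoset_mult_closed
        cong: conj_cong)
qed

lemma group_gen_wreath: "group (gen_wreath G H H')"
proof (rule groupI)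
  let ?N = "wreath_base G H H'"
  interpret N: group ?N by (rule sum_group) (rule G)
  have app: "f C \<in> carrier G" if "f \<in> carrier ?N" "C \<in> rcosets\<^bsub>H\<^esub> H'" for f C
    using that by (auto simp: carrier_wreath_base)
  show "x \<otimes>\<^bsub>gen_wreath G H H'\<^esub> y \<in> carrier (gen_wreath G H H')"
    if "x \<in> carrier (gen_wreath G H H')" "y \<in> carrier (gen_wreath G H H')" for x y
    using that N.m_closed wreath_conj_closed
    by (auto simp: gen_wreath_def simp del: mult_sum_group)
  show "\<one>\<^bsub>gen_wreath G H H'\<^esub> \<in> carrier (gen_wreath G H H')"
    using N.one_closed by (auto simp: gen_wreath_def simp del: one_sum_group)
  show "x \<otimes>\<^bsub>gen_wreath G H H'\<^esub> y \<otimes>\<^bsub>gen_wreath G H H'\<^esub> z =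
        x \<otimes>\<^bsub>gen_wreath G H H'\<^esub> (y \<otimes>\<^bsub>gen_wreath G H H'\<^esub> z)"
    if "x \<in> carrier (gen_wreath G H H')" "y \<in> carrier (gen_wreath G H H')"
       "z \<in> carrier (gen_wreath G H H')" for x y z
    using that
    by (auto simp: gen_wreath_def wreath_conj_def rcoset_mult_closed rcoset_mult_assoc
        H.m_assoc G.m_assoc app intro!: restrict_ext)
  show "\<one>\<^bsub>gen_wreath G H H'\<^esub> \<otimes>\<^bsub>gen_wreath G H H'\<^esub> x = x"
    if mem: "x \<in> carrier (gen_wreath G H H')" for x
  proof -
    obtain f h where x: "x = (f, h)" "f \<in> carrier ?N" "h \<in> carrier H"
      using mem by (auto simp: gen_wreath_def)
    have "f \<in> extensional (rcosets\<^bsub>H\<^esub> H')"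
      using x by (simp add: carrier_wreath_base PiE_def)
    moreover have "wreath_conj H H' (inv\<^bsub>H\<^esub> \<one>\<^bsub>H\<^esub>) f = restrict f (rcosets\<^bsub>H\<^esub> H')"
      unfolding wreath_conj_def by (rule restrict_ext) (simp add: rcoset_mult_one)
    ultimately show ?thesis
      using x N.l_one[of f]
      by (simp add: gen_wreath_def extensional_restrict del: mult_sum_group one_sum_group)
  qed
  show "\<exists>y\<in>carrier (gen_wreath G H H'). y \<otimes>\<^bsub>gen_wreath G H H'\<^esub> x = \<one>\<^bsub>gen_wreath G H H'\<^esub>"
    if mem: "x \<in> carrier (gen_wreath G H H')" for x
  proof -
    obtain f h where x: "x = (f, h)" "f \<in> carrier ?N" "h \<in> carrier H"
      using mem by (auto simp: gen_wreath_def)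
    let ?c = "wreath_conj H H' h f"
    have c: "?c \<in> carrier ?N" using x by (simp add: wreath_conj_closed)
    have "(inv\<^bsub>?N\<^esub> ?c, inv\<^bsub>H\<^esub> h) \<in> carrier (gen_wreath G H H')"
      using c x by (simp add: gen_wreath_def N.inv_closed del: inv_sum_group)
    moreover have "(inv\<^bsub>?N\<^esub> ?c, inv\<^bsub>H\<^esub> h) \<otimes>\<^bsub>gen_wreath G H H'\<^esub> x = \<one>\<^bsub>gen_wreath G H H'\<^esub>"
      using c x N.l_inv[OF c] by (simp add: gen_wreath_def del: inv_sum_group mult_sum_group one_sum_group)
    ultimately show ?thesis by blast
  qed
qed

text \<open>The action of \<open>H\<close> by conjugation inside the semidirect product.\<close>

lemma gen_wreath_conj:
  assumes f: "f \<in> carrier (wreath_base G H H')" and h: "h \<in> carrier H"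
  defines "h_emb \<equiv> (\<one>\<^bsub>wreath_base G H H'\<^esub>, h)"
  shows "inv\<^bsub>gen_wreath G H H'\<^esub> h_emb \<otimes>\<^bsub>gen_wreath G H H'\<^esub> (f, \<one>\<^bsub>H\<^esub>)
           \<otimes>\<^bsub>gen_wreath G H H'\<^esub> h_emb =
         ((\<lambda>C\<in>rcosets\<^bsub>H\<^esub> H'. f (C #>\<^bsub>H\<^esub> inv\<^bsub>H\<^esub> h)), \<one>\<^bsub>H\<^esub>)"
proof -
  let ?N = "wreath_base G H H'" and ?W = "gen_wreath G H H'"
  interpret N: group ?N by (rule sum_group) (rule G)
  interpret W: group ?W by (rule group_gen_wreath)
  have app: "f C \<in> carrier G" if "C \<in> rcosets\<^bsub>H\<^esub> H'" for C
    using that f by (auto simp: carrier_wreath_base)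
  have emb: "(\<one>\<^bsub>?N\<^esub>, k) \<in> carrier ?W" if "k \<in> carrier H" for k
    using that N.one_closed by (simp add: gen_wreath_def del: one_sum_group)
  have "inv\<^bsub>?W\<^esub> h_emb = (\<one>\<^bsub>?N\<^esub>, inv\<^bsub>H\<^esub> h)"
  proof (rule W.inv_equality)
    show "(\<one>\<^bsub>?N\<^esub>, inv\<^bsub>H\<^esub> h) \<otimes>\<^bsub>?W\<^esub> h_emb = \<one>\<^bsub>?W\<^esub>"
      using h by (auto simp: h_emb_def gen_wreath_def wreath_conj_def rcoset_mult_closed
          intro!: restrict_ext)
  qed (use h emb in \<open>simp_all add: h_emb_def del: one_sum_group\<close>)
  then show ?thesis
    using h by (auto simp: h_emb_def gen_wreath_def wreath_conj_def rcoset_mult_closed app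
        intro!: restrict_ext)
qed

end

end

theory Submission
  imports Defs
begin

text \<open>
  The generators of \<open>G\<close>, placed in the copy of \<open>G\<close> at the trivial coset, and those of \<open>H\<close> together
  generate the wreath product. Reading a word, its letters from \<open>H\<close> trace a walk in the Schreier
  graph of the cosets of \<open>H\<^sub>*\<close> that starts at the trivial coset, the base point. A letter from \<open>G\<close> is
  multiplied into the component at the trivial coset exactly when the walk is at the base point at
  that moment. Hence a word represents an element of the subgroup iff its walk ends at the base
  point and the letters from \<open>G\<close> that are read at the base point spell a word \<open>v\<close> of the membership
  problem of \<open>G\<^sub>*\<close> (\<open>word_value_wreath\<close>, \<open>word_value_in_subgroup_iff\<close>). Such a word arises from \<open>v\<close> by
  inserting loops at the base point in which letters from \<open>G\<close> occur only away from the base point.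
  So a grammar for \<open>G\<^sub>*\<close> turns into one for the subgroup, provided that the loops which visit the
  base point only at their two ends form a context-free language.

  That proviso is not a closure property of context-free languages; it comes from the geometry of
  the graph, in the manner of Muller and Schupp. Fix a grammar for the loops at the base point. If a
  nonterminal occurs in the derivation of a loop at a place where the walk is at \<open>p\<close>, then all of its
  words lead from \<open>p\<close> to one and the same vertex (\<open>coherent\<close>), so that this vertex is within a
  constant \<open>K\<close> of \<open>p\<close>. Let \<open>y\<close> be a walk from \<open>p\<close> that stays at least as far from the base point as
  \<open>p\<close> and ends at the distance of \<open>p\<close>. Close it up by geodesics from and to the base point and cut
  the derivation of this loop along the two ends of \<open>y\<close>: then \<open>y\<close> is cut into words of coherent
  symbols, and each division vertex is near a geodesic and therefore near an end of \<open>y\<close>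
  (\<open>chain_above\<close>). It follows that the two ends of \<open>y\<close> are at distance at most \<open>5 K\<close>
  (\<open>above_near\<close>), and that the vertex to which \<open>y\<close> leads depends only on what the graph and the
  coherence of symbols look like in a ball of fixed radius around \<open>p\<close> (\<open>above_transfer\<close>). There are
  finitely many possibilities for that.

  So there are only finitely many languages that consist of all such walks \<open>y\<close> with prescribed ends (\<open>finite_bridges\<close>). A
  finite family of languages in which every word splits according to a rule that is valid for whole
  languages is generated by the grammar of all valid rules, with the languages as nonterminals. Here
  the rules come from splitting a walk at its returns to the distance at which it starts
  (\<open>bridge_cases\<close>).
\<close>


section \<open>Grammars and the words they yield\<close>

text \<open>Parsing a sentential form from left to right makes the derivation tree available to rule
  induction, which derivation sequences do not. Nonterminals come from an arbitrary type.\<close>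

inductive yields :: "('n \<times> ('n + 'a) list) set \<Rightarrow> ('n + 'a) list \<Rightarrow> 'a list \<Rightarrow> bool" for R where
  yields_Nil: "yields R [] []"
| yields_Terminal: "yields R \<alpha> w \<Longrightarrow> yields R (Inr a # \<alpha>) (a # w)"
| yields_Nonterminal: "(A, \<beta>) \<in> R \<Longrightarrow> yields R \<beta> v \<Longrightarrow> yields R \<alpha> w \<Longrightarrow> yields R (Inl A # \<alpha>) (v @ w)"

inductive_cases yields_NilE: "yields R [] w"
inductive_cases yields_TerminalE: "yields R (Inr a # \<alpha>) w"
inductive_cases yields_NonterminalE: "yields R (Inl A # \<alpha>) w"

lemma yields_rule: "(A, \<beta>) \<in> R \<Longrightarrow> yields R \<beta> w \<Longrightarrow> yields R [Inl A] w"
  using yields_Nonterminal[of A \<beta> R w "[]" "[]"] yields_Nil by force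

lemma yields_append: "yields R \<alpha> v \<Longrightarrow> yields R \<beta> w \<Longrightarrow> yields R (\<alpha> @ \<beta>) (v @ w)"
  by (induction rule: yields.induct) (auto intro: yields.intros)

lemma yields_Cons: "yields R [s] v \<Longrightarrow> yields R \<alpha> w \<Longrightarrow> yields R (s # \<alpha>) (v @ w)"
  using yields_append[of R "[s]"] by simp

lemma yields_appendE:
  assumes "yields R (\<alpha> @ \<beta>) w"
  obtains u v where "w = u @ v" "yields R \<alpha> u" "yields R \<beta> v"
proof -
  have "\<exists>u v. w = u @ v \<and> yields R \<alpha> u \<and> yields R \<beta> v"
    using assms
  proof (induction \<alpha> arbitrary: w)
    case Nil
    then show ?case using yields_Nil by fastforce
  next
    case (Cons s \<alpha>)
    show ?case
    proof (cases s)
      case (Inl A)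
      with Cons.prems obtain \<gamma> v1 v2 where *: "(A, \<gamma>) \<in> R" "w = v1 @ v2" "yields R \<gamma> v1" "yields R (\<alpha> @ \<beta>) v2"
        by (auto elim: yields_NonterminalE)
      from Cons.IH[OF this(4)] obtain u v where "v2 = u @ v" "yields R \<alpha> u" "yields R \<beta> v" by blast
      with * Inl show ?thesis
        by (intro exI[of _ "v1 @ u"] exI[of _ v]) (auto intro: yields_Nonterminal)
    next
      case (Inr a)
      with Cons.prems obtain v2 where *: "w = a # v2" "yields R (\<alpha> @ \<beta>) v2"
        by (auto elim: yields_TerminalE)
      from Cons.IH[OF this(2)] obtain u v where "v2 = u @ v" "yields R \<alpha> u" "yields R \<beta> v" by blast
      with * Inr show ?thesis
        by (intro exI[of _ "a # u"] exI[of _ v]) (auto intro: yields_Terminal)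
    qed
  qed
  then show ?thesis using that by blast
qed

lemma yields_Inr: "yields R (map Inr w) w"
  by (induction w) (auto intro: yields.intros)

text \<open>Soundness is shown by interpreting the nonterminals by languages \<open>L\<close> that contain everything the
  rules produce from them.\<close>

fun conc :: "('n \<Rightarrow> 'a list set) \<Rightarrow> ('n + 'a) list \<Rightarrow> 'a list set" where
  "conc L [] = {[]}"
| "conc L (Inr a # \<alpha>) = {a # w | w. w \<in> conc L \<alpha>}"
| "conc L (Inl A # \<alpha>) = {v @ w | v w. v \<in> L A \<and> w \<in> conc L \<alpha>}"

lemma yields_sound:
  assumes "yields R \<alpha> w" and "\<And>A \<beta>. (A, \<beta>) \<in> R \<Longrightarrow> conc L \<beta> \<subseteq> L A"
  shows "w \<in> conc L \<alpha>"
  using assms(1) proof (induction rule: yields.induct)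
    case (yields_Nonterminal A \<beta> v \<alpha> w)
    then show ?case using assms(2)[of A \<beta>] by auto
  qed auto

fun to_sum :: "'a symbol \<Rightarrow> nat + 'a" where
  "to_sum (Nonterminal A) = Inl A"
| "to_sum (Terminal a) = Inr a"

fun from_sum :: "nat + 'a \<Rightarrow> 'a symbol" where
  "from_sum (Inl A) = Nonterminal A"
| "from_sum (Inr a) = Terminal a"

lemma from_sum_to_sum [simp]: "from_sum (to_sum s) = s"
  by (cases s) auto

lemma to_sum_from_sum [simp]: "to_sum (from_sum s) = s"
  by (cases s) auto

lemma derives_append:
  assumes "(derives_step P)\<^sup>*\<^sup>* \<alpha> \<beta>"
  shows "(derives_step P)\<^sup>*\<^sup>* (u @ \<alpha> @ v) (u @ \<beta> @ v)"
  using assms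
proof (induction rule: rtranclp_induct)
  case (step \<beta> \<gamma>)
  from step(2) have "derives_step P (u @ \<beta> @ v) (u @ \<gamma> @ v)"
  proof cases
    case (1 A \<alpha>' u' v')
    then show ?thesis
      using derives_step.intros[of A \<alpha>' P "u @ u'" "v' @ v"] by simp
  qed
  with step(3) show ?case by simp
qed simp

lemma derives_iff_yields:
  "(derives_step P)\<^sup>*\<^sup>* \<alpha> (map Terminal w) \<longleftrightarrow>
    yields ((\<lambda>(A, \<beta>). (A, map to_sum \<beta>)) ` P) (map to_sum \<alpha>) w"
  (is "?l \<longleftrightarrow> yields ?R _ _")
proof
  assume ?l
  then show "yields ?R (map to_sum \<alpha>) w"
  proof (induction rule: converse_rtranclp_induct)
    case base
    show ?case using yields_Inr[of ?R w] by (simp add: comp_def)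
  next
    case (step \<alpha> \<beta>)
    from step(1) show ?case
    proof cases
      case (1 A \<gamma> u v)
      with step(3) have "yields ?R (map to_sum u @ map to_sum \<gamma> @ map to_sum v) w" by simp
      then obtain w1 w2 w3 where "w = w1 @ w2 @ w3" "yields ?R (map to_sum u) w1"
        "yields ?R (map to_sum \<gamma>) w2" "yields ?R (map to_sum v) w3"
        by (auto elim!: yields_appendE)
      moreover from this 1 have "yields ?R [Inl A] w2"
        by (intro yields_rule[of A "map to_sum \<gamma>"]) (auto intro!: image_eqI[of _ _ "(A, \<gamma>)"])
      ultimately show ?thesis
        using 1 by (auto intro!: yields_append yields_Cons)
    qed
  qed
next
  have main: "(derives_step P)\<^sup>*\<^sup>* (map from_sum \<alpha>) (map Terminal w)" if "yields ?R \<alpha> w" for \<alpha> w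
    using that
  proof (induction rule: yields.induct)
    case (yields_Terminal \<alpha> w a)
    then show ?case using derives_append[of P _ _ "[Terminal a]" "[]"] by simp
  next
    case (yields_Nonterminal A \<beta> v \<alpha> w)
    then obtain \<gamma> where \<gamma>: "(A, \<gamma>) \<in> P" "map from_sum \<beta> = \<gamma>"
      by (auto simp: comp_def)
    have "derives_step P (Nonterminal A # map from_sum \<alpha>) (\<gamma> @ map from_sum \<alpha>)"
      using derives_step.intros[OF \<gamma>(1), of "[]" "map from_sum \<alpha>"] by simp
    also have "(derives_step P)\<^sup>*\<^sup>* (\<gamma> @ map from_sum \<alpha>) (map Terminal v @ map from_sum \<alpha>)"
      using derives_append[OF yields_Nonterminal.IH(1), of "[]" "map from_sum \<alpha>"] \<gamma> by simp
    also have "(derives_step P)\<^sup>*\<^sup>* (map Terminal v @ map from_sum \<alpha>) (map Terminal (v @ w))"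
      using derives_append[OF yields_Nonterminal.IH(2), of "map Terminal v" "[]"] by simp
    finally show ?case by simp
  qed simp
  show ?l if "yields ?R (map to_sum \<alpha>) w"
    using main[OF that] by (simp add: comp_def)
qed

lemma context_free_language_yields:
  assumes "context_free_language (L :: 'a list set)"
  obtains R :: "(nat \<times> (nat + 'a) list) set" and S
  where "finite R" "\<And>w. w \<in> L \<longleftrightarrow> yields R [Inl S] w"
proof -
  obtain P S where "finite P" "L = grammar_language P S"
    using assms by (auto simp: context_free_language_def)
  then show ?thesis
    using that[of "(\<lambda>(A, \<beta>). (A, map to_sum \<beta>)) ` P" S]
    by (simp add: grammar_language_def derives_iff_yields)
qed

text \<open>Nonterminals must be renamed injectively, whereas letters may be identified: a parse tree of the
  renamed grammar is the image of a parse tree of the original one in any case.\<close>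

lemma yields_map_iff:
  fixes R :: "('n \<times> ('n + 'a) list) set" and f :: "'n \<Rightarrow> 'm" and g :: "'a \<Rightarrow> 'b"
  defines "R' \<equiv> (\<lambda>(A, \<beta>). (f A, map (map_sum f g) \<beta>)) ` R"
  assumes inj: "inj_on f N" and N: "\<And>A \<beta>. (A, \<beta>) \<in> R \<Longrightarrow> A \<in> N \<and> set \<beta> \<subseteq> Inl ` N \<union> range Inr"
    and \<alpha>: "set \<alpha> \<subseteq> Inl ` N \<union> range Inr"
  shows "yields R' (map (map_sum f g) \<alpha>) w' \<longleftrightarrow> (\<exists>w. yields R \<alpha> w \<and> w' = map g w)"
proof
  have "\<exists>w. yields R \<alpha> w \<and> w' = map g w"
    if "yields R' \<alpha>' w'" "\<alpha>' = map (map_sum f g) \<alpha>" "set \<alpha> \<subseteq> Inl ` N \<union> range Inr" for \<alpha>' \<alpha>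
    using that
  proof (induction arbitrary: \<alpha> rule: yields.induct)
    case yields_Nil
    then show ?case by (auto intro: yields.intros)
  next
    case (yields_Terminal \<alpha>' w' b)
    then obtain a \<gamma> where *: "\<alpha> = Inr a # \<gamma>" "b = g a" "\<alpha>' = map (map_sum f g) \<gamma>"
      by (cases \<alpha>; cases "hd \<alpha>") auto
    with yields_Terminal obtain w where "yields R \<gamma> w" "w' = map g w" by auto
    then show ?case
      using * by (intro exI[of _ "a # w"]) (auto intro: yields.intros)
  next
    case (yields_Nonterminal A' \<beta>' v' \<alpha>' w')
    from yields_Nonterminal.prems yields_Nonterminal.hyps obtain A \<gamma>
      where *: "\<alpha> = Inl A # \<gamma>" "A' = f A" "\<alpha>' = map (map_sum f g) \<gamma>"
      by (cases \<alpha>; cases "hd \<alpha>") auto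
    have A: "A \<in> N" and \<gamma>: "set \<gamma> \<subseteq> Inl ` N \<union> range Inr"
      using yields_Nonterminal.prems * by auto
    obtain B \<beta> where B: "(B, \<beta>) \<in> R" "A' = f B" "\<beta>' = map (map_sum f g) \<beta>"
      using yields_Nonterminal.hyps by (auto simp: R'_def)
    have "A = B" using B * A N[OF B(1)] inj by (metis inj_onD)
    obtain v where v: "yields R \<beta> v" "v' = map g v"
      using yields_Nonterminal.IH(1)[OF B(3)] N[OF B(1)] by auto
    obtain w where w: "yields R \<gamma> w" "w' = map g w"
      using yields_Nonterminal.IH(2)[OF *(3) \<gamma>] by auto
    show ?case
      using v w B \<open>A = B\<close> * by (intro exI[of _ "v @ w"]) (auto intro: yields.intros)
  qed
  then show "yields R' (map (map_sum f g) \<alpha>) w' \<Longrightarrow> \<exists>w. yields R \<alpha> w \<and> w' = map g w"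
    using \<alpha> by blast
  have "yields R' (map (map_sum f g) \<alpha>) (map g w)" if "yields R \<alpha> w" for w \<alpha>
    using that
  proof (induction rule: yields.induct)
    case (yields_Nonterminal A \<beta> v \<alpha> w)
    then have "(f A, map (map_sum f g) \<beta>) \<in> R'" by (force simp: R'_def)
    with yields_Nonterminal show ?case by (auto intro: yields.yields_Nonterminal)
  qed (auto intro: yields.intros)
  then show "\<exists>w. yields R \<alpha> w \<and> w' = map g w \<Longrightarrow> yields R' (map (map_sum f g) \<alpha>) w'"
    by blast
qed

lemma context_free_language_map_yields:
  fixes R :: "('n \<times> ('n + 'a) list) set" and g :: "'a \<Rightarrow> 'b"
  assumes "finite R"
  shows "context_free_language (map g ` {w. yields R [Inl S] w})"
proof -
  define N where "N = insert S (fst ` R) \<union> (\<Union>(A, \<beta>)\<in>R. {B. Inl B \<in> set \<beta>})"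
  have "finite {B. Inl B \<in> set \<beta>}" for \<beta> :: "('n + 'a) list"
    by (rule finite_imageD[of Inl]) (auto intro: finite_subset[of _ "set \<beta>"])
  then have "finite N"
    using assms by (auto simp: N_def)
  then obtain f :: "'n \<Rightarrow> nat" where f: "inj_on f N"
    using finite_imp_inj_to_nat_seg by blast
  define R' where "R' = (\<lambda>(A, \<beta>). (f A, map (map_sum f g) \<beta>)) ` R"
  define P where "P = (\<lambda>(A, \<beta>). (A, map from_sum \<beta>)) ` R'"
  have "(\<lambda>(A, \<beta>). (A, map to_sum \<beta>)) ` P = R'"
    unfolding P_def image_image by (force simp: comp_def)
  moreover have rules: "A \<in> N \<and> set \<beta> \<subseteq> Inl ` N \<union> range Inr" if "(A, \<beta>) \<in> R" for A \<beta>
  proof -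
    have "s \<in> Inl ` N \<union> range Inr" if "s \<in> set \<beta>" for s
      by (cases s; use that \<open>(A, \<beta>) \<in> R\<close> in \<open>auto simp: N_def intro!: imageI bexI[of _ "(A, \<beta>)"]\<close>)
    moreover have "A \<in> N" using that by (force simp: N_def)
    ultimately show ?thesis by blast
  qed
  have "yields R' [Inl (f S)] w' \<longleftrightarrow> w' \<in> map g ` {w. yields R [Inl S] w}" for w'
    using yields_map_iff[OF f rules, where \<alpha> = "[Inl S]" and g = g and w' = w'] unfolding R'_def
    by (auto simp: N_def)
  ultimately have "map g ` {w. yields R [Inl S] w} = grammar_language P (f S)"
    by (auto simp: grammar_language_def derives_iff_yields)
  moreover have "finite P" using assms by (simp add: P_def R'_def)
  ultimately show ?thesis by (auto simp: context_free_language_def)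
qed


section \<open>Actions whose loops form a context-free language\<close>

lemma word_bar_lists: "(\<And>s. s \<in> \<Sigma> \<Longrightarrow> bar s \<in> \<Sigma>) \<Longrightarrow> w \<in> lists \<Sigma> \<Longrightarrow> word_bar bar w \<in> lists \<Sigma>"
  by (auto simp: word_bar_def)

text \<open>A connected graph with inverse edges in which the labels out of each vertex are the letters of
  \<open>\<Sigma>\<close>, and whose loops at a base point are generated by the grammar \<open>R\<close>. The Schreier graph of a
  context-free subgroup is the example to have in mind.\<close>

locale context_free_action =
  fixes \<Sigma> :: "'a set" and bar :: "'a \<Rightarrow> 'a" and V :: "'x set" and step :: "'x \<Rightarrow> 'a \<Rightarrow> 'x"
    and base :: 'x and R :: "('n \<times> ('n + 'a) list) set" and S :: 'n
  assumes finite_\<Sigma>: "finite \<Sigma>" and bar_closed: "a \<in> \<Sigma> \<Longrightarrow> bar a \<in> \<Sigma>"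
    and step_closed: "x \<in> V \<Longrightarrow> a \<in> \<Sigma> \<Longrightarrow> step x a \<in> V"
    and step_bar: "x \<in> V \<Longrightarrow> a \<in> \<Sigma> \<Longrightarrow> step (step x a) (bar a) = x"
    and base_in: "base \<in> V"
    and reachable: "x \<in> V \<Longrightarrow> \<exists>w\<in>lists \<Sigma>. foldl step base w = x"
    and finite_R: "finite R"
    and loops: "w \<in> lists \<Sigma> \<and> foldl step base w = base \<longleftrightarrow> yields R [Inl S] w"
begin

declare in_listsD [rule del] in_listsI [rule del]

abbreviation act :: "'x \<Rightarrow> 'a list \<Rightarrow> 'x" where
  "act \<equiv> foldl step"

lemma act_closed: "x \<in> V \<Longrightarrow> w \<in> lists \<Sigma> \<Longrightarrow> act x w \<in> V"
  by (induction w arbitrary: x) (auto simp: step_closed)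

lemma word_bar_closed: "w \<in> lists \<Sigma> \<Longrightarrow> word_bar bar w \<in> lists \<Sigma>"
  by (rule word_bar_lists) (rule bar_closed)

lemma length_word_bar [simp]: "length (word_bar bar w) = length w"
  by (simp add: word_bar_def)

lemma act_word_bar: "x \<in> V \<Longrightarrow> w \<in> lists \<Sigma> \<Longrightarrow> act (act x w) (word_bar bar w) = x"
  by (induction w arbitrary: x) (auto simp: word_bar_def step_bar step_closed)

lemma act_inj: "x \<in> V \<Longrightarrow> y \<in> V \<Longrightarrow> w \<in> lists \<Sigma> \<Longrightarrow> act x w = act y w \<Longrightarrow> x = y"
  by (metis act_word_bar)

definition near :: "nat \<Rightarrow> 'x \<Rightarrow> 'x \<Rightarrow> bool" where
  "near n x y \<longleftrightarrow> (\<exists>t\<in>lists \<Sigma>. length t \<le> n \<and> act x t = y)"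

lemma near_act: "t \<in> lists \<Sigma> \<Longrightarrow> length t \<le> n \<Longrightarrow> near n x (act x t)"
  by (auto simp: near_def)

lemma near_refl [simp]: "near n x x"
  using near_act[of "[]"] by simp

lemma near_mono: "near m x y \<Longrightarrow> m \<le> n \<Longrightarrow> near n x y"
  unfolding near_def using le_trans by blast

lemma near_sym: "x \<in> V \<Longrightarrow> near n x y \<Longrightarrow> near n y x"
  unfolding near_def by (metis act_word_bar word_bar_closed length_word_bar)

lemma near_trans: "near m x y \<Longrightarrow> near n y z \<Longrightarrow> near (m + n) x z"
  unfolding near_def
proof safe
  fix s t assume "s \<in> lists \<Sigma>" "t \<in> lists \<Sigma>" "length s \<le> m" "length t \<le> n"
  then show "\<exists>r\<in>lists \<Sigma>. length r \<le> m + n \<and> act x r = act (act x s) t"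
    by (intro bexI[of _ "s @ t"]) auto
qed

lemma near_closed: "x \<in> V \<Longrightarrow> near n x y \<Longrightarrow> y \<in> V"
  by (auto simp: near_def act_closed)

text \<open>The distance from the base point.\<close>

definition lev :: "'x \<Rightarrow> nat" where
  "lev x = (LEAST n. near n base x)"

lemma near_lev: "x \<in> V \<Longrightarrow> near (lev x) base x"
  unfolding lev_def using reachable[of x] by (auto intro: LeastI near_act)

lemma lev_le: "near n base x \<Longrightarrow> lev x \<le> n"
  unfolding lev_def by (rule Least_le)

lemma lev_near: "x \<in> V \<Longrightarrow> near n x y \<Longrightarrow> lev y \<le> lev x + n"
  by (rule lev_le) (rule near_trans[OF near_lev])

lemma lev_step: "x \<in> V \<Longrightarrow> a \<in> \<Sigma> \<Longrightarrow> lev (step x a) \<le> Suc (lev x)"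
  using lev_near[of x 1 "step x a"] near_act[of "[a]" 1 x] by simp

lemma lev_step_ge: "x \<in> V \<Longrightarrow> a \<in> \<Sigma> \<Longrightarrow> lev x \<le> Suc (lev (step x a))"
  using lev_step[of "step x a" "bar a"] by (simp add: step_bar step_closed bar_closed)

lemma lev_base [simp]: "lev base = 0"
  using lev_le[of 0 base] by simp

lemma lev_eq_0: "x \<in> V \<Longrightarrow> lev x = 0 \<longleftrightarrow> x = base"
  using near_lev[of x] by (auto simp: near_def)

text \<open>Exchanging two words of a nonterminal inside a derived loop yields another loop, and a common
  continuation can be undone. So every part of the derivation of a loop is coherent at the vertex
  where it starts.\<close>

definition coherent :: "'x \<Rightarrow> ('n + 'a) list \<Rightarrow> bool" where
  "coherent p \<alpha> \<longleftrightarrow> (\<exists>q. \<forall>w. yields R \<alpha> w \<longrightarrow> w \<in> lists \<Sigma> \<and> act p w = q)"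

lemma coherentD: "coherent p \<alpha> \<Longrightarrow> yields R \<alpha> v \<Longrightarrow> yields R \<alpha> w \<Longrightarrow> act p v = act p w"
  by (auto simp: coherent_def)

lemma coherent_lists: "coherent p \<alpha> \<Longrightarrow> yields R \<alpha> v \<Longrightarrow> v \<in> lists \<Sigma>"
  by (auto simp: coherent_def)

lemma coherent_start: "coherent base [Inl S]"
  using loops by (auto simp: coherent_def)

lemma coherent_Cons:
  assumes "coherent p (s # \<alpha>)" "yields R [s] v" "yields R \<alpha> w" "p \<in> V"
  shows "coherent p [s]" "coherent (act p v) \<alpha>"
proof -
  have lists: "v' \<in> lists \<Sigma> \<and> w' \<in> lists \<Sigma>" if "yields R [s] v'" "yields R \<alpha> w'" for v' w'
    using coherent_lists[OF assms(1) yields_Cons[OF that]] by simp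
  have eq: "act (act p v') w = act (act p v) w" if "yields R [s] v'" for v'
    using coherentD[OF assms(1) yields_Cons[OF that assms(3)] yields_Cons[OF assms(2,3)]] by simp
  have "act p v' = act p v" if "yields R [s] v'" for v'
    using act_inj[OF _ _ _ eq[OF that]] act_closed[OF assms(4)] lists[OF that assms(3)] lists[OF assms(2,3)]
    by blast
  then show "coherent p [s]"
    unfolding coherent_def using lists[OF _ assms(3)] by blast
  have "act (act p v) w' = act (act p v) w" if "yields R \<alpha> w'" for w'
    using coherentD[OF assms(1) yields_Cons[OF assms(2) that] yields_Cons[OF assms(2,3)]] by simp
  then show "coherent (act p v) \<alpha>"
    unfolding coherent_def using lists[OF assms(2)] by blast
qed

lemma coherent_rule: "coherent p [Inl A] \<Longrightarrow> (A, \<beta>) \<in> R \<Longrightarrow> coherent p \<beta>"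
  unfolding coherent_def by (meson yields_rule)

definition min_length :: "'n + 'a \<Rightarrow> nat" where
  "min_length s = (LEAST n. \<exists>w. yields R [s] w \<and> length w = n)"

definition weight :: "('n + 'a) list \<Rightarrow> nat" where
  "weight \<alpha> = sum_list (map min_length \<alpha>)"

lemma weight_simps [simp]: "weight [] = 0" "weight (s # \<alpha>) = min_length s + weight \<alpha>"
  by (simp_all add: weight_def)

lemma yields_min_length: "yields R [s] w \<Longrightarrow> \<exists>v. yields R [s] v \<and> length v = min_length s"
  unfolding min_length_def by (rule LeastI_ex) blast

lemma yields_weight: "yields R \<alpha> w \<Longrightarrow> \<exists>v. yields R \<alpha> v \<and> length v = weight \<alpha>"
proof (induction \<alpha> arbitrary: w)
  case (Cons s \<alpha>)
  then have "yields R ([s] @ \<alpha>) w" by simp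
  then obtain w1 w2 where "yields R [s] w1" "yields R \<alpha> w2" by (rule yields_appendE)
  then obtain v1 v2 where "yields R [s] v1" "length v1 = min_length s" "yields R \<alpha> v2" "length v2 = weight \<alpha>"
    using Cons.IH yields_min_length by blast
  then show ?case using yields_Cons[of R s v1 \<alpha> v2] by (intro exI[of _ "v1 @ v2"]) simp
qed (auto intro: yields_Nil)

lemma coherent_near: "coherent p \<alpha> \<Longrightarrow> yields R \<alpha> w \<Longrightarrow> near (weight \<alpha>) p (act p w)"
  using yields_weight[of \<alpha> w] coherentD[of p \<alpha> _ w] coherent_lists[of p \<alpha>] near_act
  by (metis order_refl)

definition symbols :: "('n + 'a) set" where
  "symbols = insert (Inl S) (\<Union>(A, \<beta>)\<in>R. set \<beta>)"

text \<open>The successor leaves room for one more letter after a word of length \<open>5 * K\<close> within the radius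
  \<open>8 * K\<close> used below.\<close>

definition K :: nat where
  "K = Suc (Max (insert (min_length (Inl S)) ((\<lambda>(A, \<beta>). weight \<beta>) ` R)))"

text \<open>The tails of right-hand sides are small, and these are the sentential forms that a parse
  visits. A part of a small coherent sentential form moves a vertex by a distance of at most \<open>K\<close>.\<close>

definition small :: "('n + 'a) list \<Rightarrow> bool" where
  "small \<alpha> \<longleftrightarrow> set \<alpha> \<subseteq> symbols \<and> weight \<alpha> \<le> K"

lemma finite_symbols: "finite symbols"
  using finite_R by (auto simp: symbols_def)

lemma K_pos: "1 \<le> K"
  by (simp add: K_def)

lemma small_start: "small [Inl S]"
  using finite_R by (auto simp: small_def symbols_def K_def intro: le_SucI)

lemma small_rule: "(A, \<beta>) \<in> R \<Longrightarrow> small \<beta>"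
  using finite_R unfolding small_def symbols_def K_def
  by (force intro!: le_SucI Max_ge)

lemma small_tail: "small (s # \<alpha>) \<Longrightarrow> small \<alpha>"
  by (auto simp: small_def)

lemma small_single: "small (s # \<alpha>) \<Longrightarrow> small [s]"
  by (auto simp: small_def)

text \<open>A walk from \<open>x\<close> along \<open>y\<close> together with a factorisation of \<open>y\<close> into words of coherent symbols
  whose division vertices, both ends included, all lie in \<open>D\<close>.\<close>

inductive chain :: "'x set \<Rightarrow> 'x \<Rightarrow> 'a list \<Rightarrow> bool" for D where
  chain_Nil: "x \<in> D \<Longrightarrow> chain D x []"
| chain_step: "x \<in> D \<Longrightarrow> small [s] \<Longrightarrow> coherent x [s] \<Longrightarrow> yields R [s] w \<Longrightarrow>
    chain D (act x w) y \<Longrightarrow> chain D x (w @ y)"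

lemma chain_mono: "chain D x y \<Longrightarrow> D \<subseteq> E \<Longrightarrow> chain E x y"
  by (induction rule: chain.induct) (auto intro: chain.intros)

lemma chain_start: "chain D x y \<Longrightarrow> x \<in> D"
  by (auto elim: chain.cases)

lemma chain_append: "chain D x y \<Longrightarrow> chain D (act x y) z \<Longrightarrow> chain D x (y @ z)"
  by (induction rule: chain.induct) (auto intro: chain.intros)

lemma chain_restrict:
  assumes "chain D x y" "\<And>y1 y2. y = y1 @ y2 \<Longrightarrow> act x y1 \<in> Z"
  shows "chain (D \<inter> Z) x y"
  using assms
proof (induction rule: chain.induct)
  case (chain_Nil x)
  then show ?case by (auto intro: chain.intros)
next
  case (chain_step x s w y)
  have "chain (D \<inter> Z) (act x w) y"
    using chain_step.prems[of "w @ _"] by (intro chain_step.IH) auto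
  then show ?case
    using chain_step.prems[of "[]"] chain_step.hyps by (intro chain.chain_step[of x _ s]) auto
qed

lemma chain_word:
  assumes "yields R \<alpha> w" "coherent p \<alpha>" "p \<in> V" "small \<alpha>" "\<And>q. near (weight \<alpha>) p q \<Longrightarrow> q \<in> D"
  shows "chain D p w"
  using assms
proof (induction \<alpha> arbitrary: w p)
  case Nil
  from Nil.prems(1) have "w = []" by (auto elim: yields_NilE)
  with Nil.prems(5)[of p] show ?case by (simp add: chain_Nil)
next
  case (Cons s \<alpha>)
  from Cons.prems(1) have "yields R ([s] @ \<alpha>) w" by simp
  then obtain v u where *: "w = v @ u" "yields R [s] v" "yields R \<alpha> u" by (rule yields_appendE)
  note coh = coherent_Cons[OF Cons.prems(2) *(2,3) Cons.prems(3)]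
  have "near (weight [s]) p (act p v)" using coherent_near[OF coh(1) *(2)] .
  then have "q \<in> D" if "near (weight \<alpha>) (act p v) q" for q
    using near_trans[OF _ that] Cons.prems(5) by simp
  then have "chain D (act p v) u"
    using Cons.prems * coh
    by (intro Cons.IH) (auto intro: act_closed small_tail coherent_lists)
  then show ?case
    unfolding *(1) using Cons.prems(5)[of p] * coh small_single[OF Cons.prems(4)]
    by (intro chain_step[of p D s]) auto
qed

text \<open>Only the nodes of the parse tree that straddle the cut are expanded. The children to the right of
  the cut begin at vertices within \<open>K\<close> of the vertex where such a node begins, and that vertex lies on
  the walk along \<open>u\<close>.\<close>

lemma chain_suffix:
  assumes "yields R \<alpha> (u @ v)" "coherent p \<alpha>" "p \<in> V" "small \<alpha>"
    "\<And>u1 u2 q. u = u1 @ u2 \<Longrightarrow> near K (act p u1) q \<Longrightarrow> q \<in> D"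
  shows "chain D (act p u) v"
  using assms
proof (induction \<alpha> "u @ v" arbitrary: u v p rule: yields.induct)
  case yields_Nil
  then show ?case using yields_Nil.prems(4)[of "[]" "[]" p] by (simp add: chain_Nil)
next
  case (yields_Terminal \<alpha> w a)
  have s: "yields R [Inr a] [a]" using yields_Inr[of R "[a]"] by simp
  note coh = coherent_Cons[OF yields_Terminal.prems(1) s yields_Terminal.hyps(1) yields_Terminal.prems(2)]
  show ?case
  proof (cases u)
    case Nil
    have "chain D p (a # w)"
      using yields_Terminal.prems yields_Terminal.prems(4)[of "[]" "[]"] Nil
      by (intro chain_word[of "Inr a # \<alpha>"])
        (auto intro: yields.yields_Terminal yields_Terminal.hyps(1) near_mono simp: small_def)
    with Nil yields_Terminal.hyps show ?thesis by simp
  next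
    case (Cons b u')
    then have u: "u = a # u'" "w = u' @ v" using yields_Terminal.hyps by auto
    have "chain D (act (act p [a]) u') v"
    proof (rule yields_Terminal.hyps(2)[OF u(2) coh(2)])
      show "act p [a] \<in> V" using coherent_lists[OF coh(1) s] yields_Terminal.prems(2) by (intro act_closed)
      show "small \<alpha>" using yields_Terminal.prems(3) by (rule small_tail)
      show "q \<in> D" if "u' = u1 @ u2" "near K (act (act p [a]) u1) q" for u1 u2 q
        using that u yields_Terminal.prems(4)[of "a # u1" u2 q] by simp
    qed
    then show ?thesis using u by simp
  qed
next
  case (yields_Nonterminal A \<beta> w1 \<alpha> w2)
  have s: "yields R [Inl A] w1" using yields_Nonterminal.hyps by (intro yields_rule[of A \<beta>])
  note coh = coherent_Cons[OF yields_Nonterminal.prems(1) s yields_Nonterminal.hyps(4) yields_Nonterminal.prems(2)]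
  have pw1: "act p w1 \<in> V" using coherent_lists[OF coh(1) s] yields_Nonterminal.prems(2) by (intro act_closed)
  consider t where "u = w1 @ t" "w2 = t @ v" | t where "w1 = u @ t" "v = t @ w2"
    using yields_Nonterminal.hyps(6) by (auto simp: append_eq_append_conv2)
  then show ?case
  proof cases
    case 1
    have "chain D (act (act p w1) t) v"
    proof (rule yields_Nonterminal.hyps(5)[OF 1(2) coh(2) pw1])
      show "small \<alpha>" using yields_Nonterminal.prems(3) by (rule small_tail)
      show "q \<in> D" if "t = u1 @ u2" "near K (act (act p w1) u1) q" for u1 u2 q
        using that 1 yields_Nonterminal.prems(4)[of "w1 @ u1" u2 q] by simp
    qed
    then show ?thesis using 1 by simp
  next
    case 2
    have "chain D (act p u) t"
      using yields_Nonterminal.prems coherent_rule[OF coh(1) yields_Nonterminal.hyps(1)]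
        small_rule[OF yields_Nonterminal.hyps(1)]
      by (intro yields_Nonterminal.hyps(3)[OF 2(1)])
    moreover have "chain D (act p w1) w2"
    proof (rule chain_word[OF yields_Nonterminal.hyps(4) coh(2) pw1])
      show "small \<alpha>" using yields_Nonterminal.prems(3) by (rule small_tail)
      fix q assume "near (weight \<alpha>) (act p w1) q"
      with coherent_near[OF coh(1) s] have "near (weight [Inl A] + weight \<alpha>) p q"
        by (rule near_trans)
      then have "near K p q"
        by (rule near_mono) (use yields_Nonterminal.prems(3) in \<open>simp add: small_def\<close>)
      then show "q \<in> D" using yields_Nonterminal.prems(4)[of "[]" u q] by simp
    qed
    ultimately show ?thesis using 2 by (auto intro: chain_append)
  qed
qed

text \<open>The mirror image: a straddling node ends on the walk along \<open>v\<close>, and its children to the left of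
  the cut begin within \<open>K\<close> of that end.\<close>

lemma chain_prefix:
  assumes "yields R \<alpha> (u @ v)" "coherent p \<alpha>" "p \<in> V" "small \<alpha>"
    "\<And>v1 v2 q. v = v1 @ v2 \<Longrightarrow> near K (act p (u @ v1)) q \<Longrightarrow> q \<in> D"
  shows "chain D p u"
  using assms
proof (induction \<alpha> "u @ v" arbitrary: u v p rule: yields.induct)
  case yields_Nil
  then show ?case using yields_Nil.prems(4)[of "[]" "[]" p] by (simp add: chain_Nil)
next
  case (yields_Terminal \<alpha> w a)
  have s: "yields R [Inr a] [a]" using yields_Inr[of R "[a]"] by simp
  note coh = coherent_Cons[OF yields_Terminal.prems(1) s yields_Terminal.hyps(1) yields_Terminal.prems(2)]
  have "near (weight (Inr a # \<alpha>)) p (act p (a # w))"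
    by (rule coherent_near[OF yields_Terminal.prems(1)])
      (rule yields.yields_Terminal[OF yields_Terminal.hyps(1)])
  then have "near K p (act p (u @ v))"
    unfolding yields_Terminal.hyps(3) using yields_Terminal.prems(3) by (auto simp: small_def elim: near_mono)
  with yields_Terminal.prems(2) have "near K (act p (u @ v)) p" by (rule near_sym)
  then have p: "p \<in> D" using yields_Terminal.prems(4)[of v "[]" p] by simp
  show ?case
  proof (cases u)
    case Nil
    with p show ?thesis by (simp add: chain_Nil)
  next
    case (Cons b u')
    then have u: "u = a # u'" "w = u' @ v" using yields_Terminal.hyps by auto
    have "chain D (act p [a]) u'"
    proof (rule yields_Terminal.hyps(2)[OF u(2) coh(2)])
      show "act p [a] \<in> V" using coherent_lists[OF coh(1) s] yields_Terminal.prems(2) by (intro act_closed)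
      show "small \<alpha>" using yields_Terminal.prems(3) by (rule small_tail)
      show "q \<in> D" if "v = v1 @ v2" "near K (act (act p [a]) (u' @ v1)) q" for v1 v2 q
        using that u yields_Terminal.prems(4)[of v1 v2 q] by simp
    qed
    then show ?thesis
      using u p s coh chain_step[of p D "Inr a" "[a]" u'] small_single[OF yields_Terminal.prems(3)]
      by simp
  qed
next
  case (yields_Nonterminal A \<beta> w1 \<alpha> w2)
  have s: "yields R [Inl A] w1" using yields_Nonterminal.hyps by (intro yields_rule[of A \<beta>])
  note coh = coherent_Cons[OF yields_Nonterminal.prems(1) s yields_Nonterminal.hyps(4) yields_Nonterminal.prems(2)]
  have pw1: "act p w1 \<in> V" using coherent_lists[OF coh(1) s] yields_Nonterminal.prems(2) by (intro act_closed)
  have "near (weight (Inl A # \<alpha>)) p (act p (w1 @ w2))"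
    using yields_Nonterminal.prems(1) by (rule coherent_near)
      (rule yields.yields_Nonterminal[OF yields_Nonterminal.hyps(1,2,4)])
  then have "near K p (act p (u @ v))"
    unfolding yields_Nonterminal.hyps(6) using yields_Nonterminal.prems(3)
    by (auto simp: small_def elim: near_mono)
  with yields_Nonterminal.prems(2) have "near K (act p (u @ v)) p" by (rule near_sym)
  then have p: "p \<in> D" using yields_Nonterminal.prems(4)[of v "[]" p] by simp
  consider t where "u = w1 @ t" "w2 = t @ v" | t where "w1 = u @ t" "v = t @ w2"
    using yields_Nonterminal.hyps(6) by (auto simp: append_eq_append_conv2)
  then show ?case
  proof cases
    case 1
    have "chain D (act p w1) t"
    proof (rule yields_Nonterminal.hyps(5)[OF 1(2) coh(2) pw1])
      show "small \<alpha>" using yields_Nonterminal.prems(3) by (rule small_tail)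
      show "q \<in> D" if "v = v1 @ v2" "near K (act (act p w1) (t @ v1)) q" for v1 v2 q
        using that 1 yields_Nonterminal.prems(4)[of v1 v2 q] by simp
    qed
    then show ?thesis
      using 1 p s coh(1) chain_step[of p D "Inl A" w1 t] small_single[OF yields_Nonterminal.prems(3)]
      by simp
  next
    case 2
    show ?thesis
    proof (rule yields_Nonterminal.hyps(3)[OF 2(1)])
      show "coherent p \<beta>" by (rule coherent_rule[OF coh(1) yields_Nonterminal.hyps(1)])
      show "small \<beta>" by (rule small_rule[OF yields_Nonterminal.hyps(1)])
      show "q \<in> D" if "t = v1 @ v2" "near K (act p (u @ v1)) q" for v1 v2 q
        using that 2 yields_Nonterminal.prems(4)[of v1 "v2 @ w2" q] by simp
    qed (rule yields_Nonterminal.prems(2))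
  qed
qed

text \<open>The same cut for a chain, of which at most one factor is straddling.\<close>

lemma chain_cut:
  assumes "chain D x (y @ v)" "x \<in> V"
    "\<And>v1 v2 q. v = v1 @ v2 \<Longrightarrow> near K (act x (y @ v1)) q \<Longrightarrow> q \<in> D"
  shows "chain D x y"
  using assms
proof (induction x "y @ v" arbitrary: y v rule: chain.induct)
  case (chain_Nil x)
  then show ?case by (simp add: chain.chain_Nil)
next
  case (chain_step x s w z)
  have xw: "act x w \<in> V"
    using chain_step.prems(1) coherent_lists[OF chain_step.hyps(3,4)] by (rule act_closed)
  consider t where "y = w @ t" "z = t @ v" | t where "w = y @ t" "v = t @ z"
    using chain_step.hyps(7) by (auto simp: append_eq_append_conv2)
  then show ?case
  proof cases
    case 1
    have "chain D (act x w) t"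
      using chain_step.prems(2) 1 by (intro chain_step.hyps(6)[OF 1(2) xw]) auto
    then show ?thesis
      unfolding 1(1) by (rule chain.chain_step[OF chain_step.hyps(1-4)])
  next
    case 2
    show ?thesis
    proof (rule chain_prefix[OF _ chain_step.hyps(3) chain_step.prems(1) chain_step.hyps(2)])
      show "yields R [s] (y @ t)" using 2 chain_step.hyps by simp
      show "q \<in> D" if "t = v1 @ v2" "near K (act x (y @ v1)) q" for v1 v2 q
        using that 2 chain_step.prems(2)[of v1 "v2 @ z" q] by simp
    qed
  qed
qed

lemma chain_middle:
  assumes "u @ y @ v \<in> lists \<Sigma>" "act base (u @ y @ v) = base"
  shows "chain ({q. \<exists>u1 u2. u = u1 @ u2 \<and> near K (act base u1) q} \<union>
    {q. \<exists>v1 v2. v = v1 @ v2 \<and> near K (act (act (act base u) y) v1) q}) (act base u) y"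
    (is "chain (?D1 \<union> ?D2) _ _")
proof -
  have "yields R [Inl S] (u @ y @ v)"
    using assms by (simp add: loops[symmetric])
  then have "chain ?D1 (act base u) (y @ v)"
    by (rule chain_suffix[OF _ coherent_start base_in small_start]) blast
  then have "chain (?D1 \<union> ?D2) (act base u) (y @ v)"
    by (rule chain_mono) simp
  then show ?thesis
  proof (rule chain_cut)
    show "act base u \<in> V" using assms(1) by (intro act_closed base_in) simp
  qed (simp, blast)
qed


subsection \<open>Excursions that stay away from the base point\<close>


definition above :: "nat \<Rightarrow> 'x \<Rightarrow> 'a list \<Rightarrow> bool" where
  "above n x w \<longleftrightarrow> (\<forall>u v. w = u @ v \<longrightarrow> n \<le> lev (act x u))"

lemma aboveD: "above n x (u @ v) \<Longrightarrow> n \<le> lev (act x u)"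
  by (auto simp: above_def)

lemma above_start: "above n x w \<Longrightarrow> n \<le> lev x"
  using aboveD[of n x "[]" w] by simp

lemma above_Nil [simp]: "above n x [] \<longleftrightarrow> n \<le> lev x"
  by (auto simp: above_def)

lemma above_Cons [simp]: "above n x (a # w) \<longleftrightarrow> n \<le> lev x \<and> above n (step x a) w"
proof
  assume *: "above n x (a # w)"
  have "n \<le> lev (act (step x a) u)" if "w = u @ v" for u v
    using aboveD[of n x "a # u" v] * that by simp
  then show "n \<le> lev x \<and> above n (step x a) w"
    using above_start[OF *] by (simp add: above_def)
next
  assume *: "n \<le> lev x \<and> above n (step x a) w"
  have "n \<le> lev (act x u)" if "a # w = u @ v" for u v
    using * that by (cases u) (auto dest: aboveD)
  then show "above n x (a # w)" by (simp add: above_def)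
qed

lemma above_append: "above n x (u @ v) \<longleftrightarrow> above n x u \<and> above n (act x u) v"
  by (induction u arbitrary: x) (auto dest: above_start)

lemma above_le: "above n x w \<Longrightarrow> m \<le> n \<Longrightarrow> above m x w"
  unfolding above_def using le_trans[of m n] by blast

text \<open>Take geodesics for \<open>u\<close> and \<open>v\<close> in \<open>chain_middle\<close>. A division vertex is on the walk along \<open>y\<close>, so
  its level is at least that of \<open>p\<close>. If it is within \<open>K\<close> of a vertex of a geodesic, then that vertex
  has level at least \<open>lev p - K\<close> and so is within \<open>K\<close> of the end of the geodesic at \<open>p\<close> or
  \<open>act p y\<close>.\<close>

lemma chain_above:
  assumes p: "p \<in> V" and y: "y \<in> lists \<Sigma>" and lev: "lev (act p y) = lev p"
    and above: "above (lev p) p y"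
  shows "chain {q. near (2 * K) p q \<or> near (2 * K) (act p y) q} p y"
proof -
  let ?q = "act p y"
  have q: "?q \<in> V" using p y by (rule act_closed)
  obtain u where u: "u \<in> lists \<Sigma>" "length u \<le> lev p" "act base u = p"
    using near_lev[OF p] by (auto simp: near_def)
  obtain t where t: "t \<in> lists \<Sigma>" "length t \<le> lev p" "act base t = ?q"
    using near_lev[OF q] lev by (auto simp: near_def)
  define v where "v = word_bar bar t"
  have v: "v \<in> lists \<Sigma>" "length v \<le> lev p" "act ?q v = base"
    using t word_bar_closed act_word_bar[OF base_in t(1)] by (auto simp: v_def)
  have "chain ({q. \<exists>u1 u2. u = u1 @ u2 \<and> near K (act base u1) q} \<union>
    {q. \<exists>v1 v2. v = v1 @ v2 \<and> near K (act (act (act base u) y) v1) q}) (act base u) y"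
    (is "chain (?D1 \<union> ?D2) _ _")
    using u v y by (intro chain_middle) auto
  then have "chain ((?D1 \<union> ?D2) \<inter> {q. lev p \<le> lev q}) p y"
    unfolding u(3) by (rule chain_restrict) (use above in \<open>auto dest: aboveD\<close>)
  then show ?thesis
  proof (rule chain_mono, intro subsetI)
    fix r assume r: "r \<in> (?D1 \<union> ?D2) \<inter> {q. lev p \<le> lev q}"
    then consider (left) u1 u2 where "u = u1 @ u2" "near K (act base u1) r"
      | (right) v1 v2 where "v = v1 @ v2" "near K (act ?q v1) r"
      using u(3) by auto
    then show "r \<in> {r. near (2 * K) p r \<or> near (2 * K) ?q r}"
    proof cases
      case left
      have u12: "u1 \<in> lists \<Sigma>" "u2 \<in> lists \<Sigma>" using u(1) left(1) by auto
      have "near (length u1 + K) base r"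
        using near_act[OF u12(1), of _ base] left(2) by (blast intro: near_trans)
      then have "length u2 \<le> K"
        using lev_le[of "length u1 + K" r] r u(2) left(1) by auto
      then have "near K (act base u1) p"
        using near_act[OF u12(2), of K "act base u1"] left(1) u(3) by simp
      then have "near K p (act base u1)"
        by (rule near_sym[rotated]) (rule act_closed[OF base_in u12(1)])
      then show ?thesis
        using near_trans[OF _ left(2)] by (simp add: mult_2)
    next
      case right
      have v12: "v1 \<in> lists \<Sigma>" "v2 \<in> lists \<Sigma>" using v(1) right(1) by auto
      have "near (length v2) (act ?q v1) base"
        using near_act[OF v12(2), of "length v2" "act ?q v1"] right(1) v(3) by simp
      then have "near (length v2) base (act ?q v1)"
        by (rule near_sym[rotated]) (rule act_closed[OF q v12(1)])
      then have "near (length v2 + K) base r"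
        using right(2) by (rule near_trans)
      then have "length v1 \<le> K"
        using lev_le[of "length v2 + K" r] r v(2) right(1) by auto
      then have "near K ?q (act ?q v1)"
        using near_act[OF v12(1)] by blast
      then show ?thesis
        using near_trans[OF _ right(2)] by (simp add: mult_2)
    qed
  qed
qed

lemma small_near:
  "small [s] \<Longrightarrow> coherent x [s] \<Longrightarrow> yields R [s] w \<Longrightarrow> near K x (act x w)"
  using coherent_near[of x "[s]" w] near_mono[of "weight [s]" x "act x w" K] by (auto simp: small_def)

text \<open>The chain starts near \<open>p\<close> and ends near the other end of \<open>y\<close>. At the factor where it passes from
  the neighbourhood of one to that of the other, the distance is at most \<open>2 K + K + 2 K\<close>.\<close>

lemma above_near:
  assumes p: "p \<in> V" and y: "y \<in> lists \<Sigma>" and lev: "lev (act p y) = lev p"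
    and above: "above (lev p) p y"
  shows "near (5 * K) p (act p y)"
proof -
  have "near (5 * K) p q"
    if "chain {r. near (2 * K) p r \<or> near (2 * K) q r} x z" "near (2 * K) p x" "act x z = q" "q \<in> V" for x z q
    using that
  proof (induction rule: chain.induct)
    case (chain_Nil x)
    then show ?case using near_mono[of "2 * K" p x "5 * K"] by simp
  next
    case (chain_step x s w z)
    show ?case
    proof (cases "near (2 * K) p (act x w)")
      case True
      then show ?thesis using chain_step by simp
    next
      case False
      then have "near (2 * K) q (act x w)" using chain_start[OF chain_step.hyps(5)] by simp
      then have "near (2 * K) (act x w) q" using chain_step.prems(3) by (rule near_sym[rotated])
      moreover have "near K x (act x w)"
        using chain_step.hyps by (intro small_near)
      ultimately have "near (2 * K + (K + 2 * K)) p q"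
        using chain_step.prems(1) by (blast intro: near_trans)
      then show ?thesis by simp
    qed
  qed
  then show ?thesis
    using chain_above[OF assms] act_closed[OF p y] by simp
qed

text \<open>The radius covers the division vertices, at distance at most \<open>5 K + 2 K\<close> from \<open>p\<close>, followed by a
  shortest word of a symbol, of length at most \<open>K\<close>.\<close>

definition ball_words :: "'a list set" where
  "ball_words = {s \<in> lists \<Sigma>. length s \<le> 8 * K}"

lemma finite_ball_words: "finite ball_words"
  using finite_lists_length_le[OF finite_\<Sigma>] by (simp add: ball_words_def lists_eq_set)

text \<open>What can be seen from \<open>p\<close> within the radius: which words lead to the same vertex, which symbols
  are coherent where, and the levels relative to that of \<open>p\<close>. The levels are shifted by \<open>8 * K\<close> to
  make the differences natural numbers.\<close>

definition local_type ::
  "'x \<Rightarrow> ('a list \<times> 'a list) set \<times> ('a list \<times> ('n + 'a)) set \<times> ('a list \<times> nat) set" where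
  "local_type p =
    ({(s, t). s \<in> ball_words \<and> t \<in> ball_words \<and> act p s = act p t},
     {(s, c). s \<in> ball_words \<and> c \<in> symbols \<and> coherent (act p s) [c]},
     {(s, k). s \<in> ball_words \<and> k \<le> 16 * K \<and> lev (act p s) + 8 * K = lev p + k})"

lemma finite_local_type: "finite (range local_type)"
proof (rule finite_subset)
  show "range local_type \<subseteq> Pow (ball_words \<times> ball_words) \<times> Pow (ball_words \<times> symbols)
    \<times> Pow (ball_words \<times> {..16 * K})"
    by (auto simp: local_type_def)
qed (use finite_ball_words finite_symbols in auto)

lemma local_type_act:
  assumes "local_type p = local_type p'" "s \<in> ball_words" "t \<in> ball_words" "act p s = act p t"
  shows "act p' s = act p' t"
proof -
  have "(s, t) \<in> fst (local_type p)" using assms(2-) by (simp add: local_type_def)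
  then show ?thesis unfolding assms(1) by (simp add: local_type_def)
qed

lemma local_type_coherent:
  assumes "local_type p = local_type p'" "s \<in> ball_words" "c \<in> symbols" "coherent (act p s) [c]"
  shows "coherent (act p' s) [c]"
proof -
  have "(s, c) \<in> fst (snd (local_type p))" using assms(2-) by (simp add: local_type_def)
  then show ?thesis unfolding assms(1) by (simp add: local_type_def)
qed

lemma local_type_lev:
  assumes "local_type p = local_type p'" "s \<in> ball_words" "p \<in> V"
  shows "lev (act p' s) + lev p = lev (act p s) + lev p'"
proof -
  have s: "s \<in> lists \<Sigma>" "length s \<le> 8 * K" using assms by (auto simp: ball_words_def)
  have n: "near (8 * K) p (act p s)" using s by (rule near_act)
  have l1: "lev (act p s) \<le> lev p + 8 * K" using lev_near[OF assms(3) n] .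
  have l2: "lev p \<le> lev (act p s) + 8 * K"
    using lev_near[OF near_closed[OF assms(3) n] near_sym[OF assms(3) n]] .
  define k where "k = lev (act p s) + 8 * K - lev p"
  have k: "lev (act p s) + 8 * K = lev p + k" "k \<le> 16 * K"
    using l1 l2 by (auto simp: k_def)
  then have "(s, k) \<in> snd (snd (local_type p))" using assms(2-) by (simp add: local_type_def)
  then have "lev (act p' s) + 8 * K = lev p' + k" unfolding assms(1) by (simp add: local_type_def)
  with k show ?thesis by simp
qed

text \<open>The factors of the chain can be replaced by shortest words of their symbols without changing the
  division vertices, and the walk so obtained never leaves the ball that the type describes. Since
  the symbols are coherent around \<open>p'\<close> as well, the replacement can be reversed there.\<close>

lemma chain_transfer:
  assumes type: "local_type p = local_type p'"
    and "chain {q. near (7 * K) p q} x y" and "x = act p t" and "t \<in> lists \<Sigma>" "length t \<le> 7 * K"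
    and "act x y = act p s" and "s \<in> lists \<Sigma>" "length s \<le> 7 * K"
  shows "act (act p' t) y = act p' s"
  using assms(2-)
proof (induction arbitrary: t rule: chain.induct)
  case (chain_Nil x)
  then show ?case
    using local_type_act[OF type, of t s] by (simp add: ball_words_def)
next
  case (chain_step x c w y)
  obtain t2 where t2: "t2 \<in> lists \<Sigma>" "length t2 \<le> 7 * K" "act p t2 = act x w"
    using chain_start[OF chain_step.hyps(5)] by (auto simp: near_def)
  obtain v where v: "yields R [c] v" "length v = weight [c]"
    using yields_weight[OF chain_step.hyps(4)] by blast
  have vl: "v \<in> lists \<Sigma>" "length v \<le> K"
    using coherent_lists[OF chain_step.hyps(3) v(1)] v(2) chain_step.hyps(2) by (auto simp: small_def)
  have "act p (t @ v) = act p t2"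
    using coherentD[OF chain_step.hyps(3) v(1) chain_step.hyps(4)] chain_step.prems(1) t2(3) by simp
  then have eq: "act p' (t @ v) = act p' t2"
    using chain_step.prems t2 vl by (intro local_type_act[OF type]) (auto simp: ball_words_def)
  have "coherent (act p' t) [c]"
    using chain_step.prems chain_step.hyps
    by (intro local_type_coherent[OF type]) (auto simp: ball_words_def small_def)
  then have "act (act p' t) w = act (act p' t) v"
    by (rule coherentD) (fact chain_step.hyps(4) v(1))+
  then have "act (act p' t) w = act p' t2" using eq by simp
  then show ?case
    using chain_step.IH[of t2] t2 chain_step.prems by simp
qed

lemma above_transfer:
  assumes type: "local_type p = local_type p'" and p: "p \<in> V" and y: "y \<in> lists \<Sigma>"
    and lev: "lev (act p y) = lev p" and above: "above (lev p) p y"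
    and s: "s \<in> lists \<Sigma>" "length s \<le> 5 * K" "act p y = act p s"
  shows "act p' y = act p' s"
proof -
  have "near (5 * K + 2 * K) p q" if "near (2 * K) (act p y) q" for q
    using near_trans[OF near_act[OF s(1,2)] that[unfolded s(3)]] .
  moreover have "near (7 * K) p q" if "near (2 * K) p q" for q
    using that by (rule near_mono) simp
  ultimately have "chain {q. near (7 * K) p q} p y"
    by (intro chain_mono[OF chain_above[OF p y lev above]]) auto
  then show ?thesis
    using chain_transfer[OF type, of p y "[]" s] s by simp
qed

text \<open>The walks from \<open>p\<close> to \<open>act p s\<close>, two vertices of the same level, that never go below this
  level.\<close>

definition bridge :: "'x \<Rightarrow> 'a list \<Rightarrow> 'a list set" where
  "bridge p s = {y \<in> lists \<Sigma>. act p y = act p s \<and> lev (act p s) = lev p \<and> above (lev p) p y}"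

text \<open>That \<open>y\<close> leads from \<open>p'\<close> to the right vertex is \<open>above_transfer\<close>. It also stays above the level of
  \<open>p'\<close>: up to the first step below this level, the same transfer in the opposite direction applies,
  and so the corresponding step of the walk from \<open>p\<close> would go below the level of \<open>p\<close>.\<close>

lemma bridge_subset:
  assumes type: "local_type p = local_type p'" and p: "p \<in> V" "p' \<in> V"
    and s: "s \<in> lists \<Sigma>" "length s \<le> 5 * K"
  shows "bridge p s \<subseteq> bridge p' s"
proof
  fix y assume "y \<in> bridge p s"
  then have y: "y \<in> lists \<Sigma>" "act p y = act p s" "lev (act p s) = lev p" "above (lev p) p y"
    by (auto simp: bridge_def)
  have "s \<in> ball_words" using s by (auto simp: ball_words_def)
  have above': "above (lev p') p' z" if "y = z @ z'" for z z'
    using that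
  proof (induction z arbitrary: z' rule: rev_induct)
    case (snoc b z)
    have above: "above (lev p') p' z" using snoc.prems by (intro snoc.IH[of "b # z'"]) simp
    have zb: "z \<in> lists \<Sigma>" "b \<in> \<Sigma>" using snoc.prems y(1) by auto
    have "lev p' \<le> lev (step (act p' z) b)"
    proof (rule ccontr)
      assume less: "\<not> lev p' \<le> lev (step (act p' z) b)"
      have "lev p' \<le> lev (act p' z)" using above aboveD[of _ _ z "[]"] by simp
      with less have z: "lev (act p' z) = lev p'"
        using lev_step_ge[OF act_closed[OF p(2) zb(1)] zb(2)] by simp
      obtain t where t: "t \<in> lists \<Sigma>" "length t \<le> 5 * K" "act p' z = act p' t"
        using above_near[OF p(2) zb(1) z above] unfolding near_def by metis
      have "act p z = act p t"
        using above_transfer[OF type[symmetric] p(2) zb(1) z above t] .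
      moreover have "lev p \<le> lev (step (act p z) b)"
        using aboveD[of "lev p" p "z @ [b]" z'] y(4) snoc.prems by simp
      moreover have "t @ [b] \<in> ball_words"
        using t zb K_pos by (auto simp: ball_words_def)
      ultimately show False
        using local_type_lev[OF type _ p(1), of "t @ [b]"] t(3) less by simp
    qed
    with above aboveD[of _ _ z "[]"] show ?case by (simp add: above_append)
  qed simp
  have "act p' y = act p' s"
    using above_transfer[OF type p(1) y(1) _ y(4) s y(2)] y(2,3) by simp
  moreover have "lev (act p' s) = lev p'"
    using local_type_lev[OF type \<open>s \<in> ball_words\<close> p(1)] y(3) by simp
  ultimately show "y \<in> bridge p' s"
    using y(1) above'[of y "[]"] by (simp add: bridge_def)
qed

text \<open>By \<open>above_near\<close>, the bound on \<open>s\<close> excludes no nonempty language of this form.\<close>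

definition bridges :: "'a list set set" where
  "bridges = {bridge p s | p s. p \<in> V \<and> s \<in> lists \<Sigma> \<and> length s \<le> 5 * K}"

lemma finite_bridges: "finite bridges"
proof -
  let ?T = "range local_type" and ?W = "{s \<in> lists \<Sigma>. length s \<le> 5 * K}"
  let ?f = "\<lambda>(t, s). bridge (SOME p. p \<in> V \<and> local_type p = t) s"
  have "bridge p s \<in> ?f ` (?T \<times> ?W)" if "p \<in> V" "s \<in> ?W" for p s
  proof -
    define p' where "p' = (SOME q. q \<in> V \<and> local_type q = local_type p)"
    have "p' \<in> V \<and> local_type p' = local_type p"
      unfolding p'_def by (rule someI[of _ p]) (simp add: that)
    then have "bridge p s = bridge p' s"
      using bridge_subset[of p p' s] bridge_subset[of p' p s] that by auto
    also have "\<dots> = ?f (local_type p, s)" by (simp add: p'_def)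
    finally show ?thesis using that by blast
  qed
  then have "bridges \<subseteq> ?f ` (?T \<times> ?W)" by (auto simp: bridges_def)
  moreover have "finite ?W"
    by (rule finite_subset[OF _ finite_ball_words]) (auto simp: ball_words_def)
  ultimately show ?thesis
    using finite_local_type by (blast intro: finite_subset)
qed

lemma bridge_mem:
  assumes "p \<in> V" "y \<in> lists \<Sigma>" "lev (act p y) = lev p" "above (lev p) p y"
  obtains s where "bridge p s \<in> bridges" "y \<in> bridge p s" "act p s = act p y"
proof -
  obtain s where s: "s \<in> lists \<Sigma>" "length s \<le> 5 * K" "act p s = act p y"
    using above_near[OF assms] by (auto simp: near_def)
  have "bridge p s \<in> bridges"
    using assms(1) s unfolding bridges_def by blast
  moreover have "y \<in> bridge p s"
    using assms s by (simp add: bridge_def)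
  ultimately show ?thesis using s(3) by (rule that)
qed

lemma first_descent:
  assumes "x \<in> V" "w \<in> lists \<Sigma>" "n < lev x" "lev (act x w) \<le> n"
  obtains u b v where "w = u @ b # v" "above (Suc n) x u" "lev (act x u) = Suc n" "lev (act x (u @ [b])) = n"
proof -
  have "\<exists>u b v. w = u @ b # v \<and> above (Suc n) x u \<and> lev (act x u) = Suc n \<and> lev (act x (u @ [b])) = n"
    using assms
  proof (induction w arbitrary: x)
    case (Cons a w)
    then have a: "a \<in> \<Sigma>" "w \<in> lists \<Sigma>" by auto
    show ?case
    proof (cases "n < lev (step x a)")
      case True
      then obtain u b v where "w = u @ b # v" "above (Suc n) (step x a) u" "lev (act (step x a) u) = Suc n"
        "lev (act (step x a) (u @ [b])) = n"
        using Cons.IH[of "step x a"] Cons.prems a step_closed by auto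
      then show ?thesis
        using Cons.prems by (intro exI[of _ "a # u"] exI[of _ b] exI[of _ v]) auto
    next
      case False
      then show ?thesis
        using Cons.prems lev_step_ge[OF Cons.prems(1) a(1)]
        by (intro exI[of _ "[]"] exI[of _ a] exI[of _ w]) auto
    qed
  qed simp
  then show ?thesis using that by blast
qed

text \<open>A nonempty word of a bridge starts with a step along its level or with a step up. In the second case it is
  split at the first return to its level. The parts are words of bridges again, and any other words of
  these bridges could take their places.\<close>

lemma bridge_cases:
  assumes "B \<in> bridges" "y \<in> B"
  obtains (Nil) "y = []"
    | (level) a z C where "y = a # z" "a \<in> \<Sigma>" "C \<in> bridges" "z \<in> C" "\<And>z. z \<in> C \<Longrightarrow> a # z \<in> B"
    | (excursion) a z b z' C D where "y = a # z @ b # z'" "a \<in> \<Sigma>" "b \<in> \<Sigma>" "C \<in> bridges" "z \<in> C"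
      "D \<in> bridges" "z' \<in> D" "\<And>z z'. z \<in> C \<Longrightarrow> z' \<in> D \<Longrightarrow> a # z @ b # z' \<in> B"
proof (cases y)
  case (Cons a y')
  obtain p s where B: "B = bridge p s" "p \<in> V" "s \<in> lists \<Sigma>"
    using assms by (auto simp: bridges_def)
  let ?n = "lev p" and ?pa = "step p a"
  have y: "a \<in> \<Sigma>" "y' \<in> lists \<Sigma>" "act ?pa y' = act p s" "lev (act p s) = ?n" "above ?n ?pa y'"
    using assms B Cons by (auto simp: bridge_def)
  have pa: "?pa \<in> V" using B y by (simp add: step_closed)
  have ge: "?n \<le> lev ?pa" using aboveD[of ?n ?pa "[]" y'] y by simp
  show ?thesis
  proof (cases "lev ?pa = ?n")
    case True
    obtain t where t: "bridge ?pa t \<in> bridges" "y' \<in> bridge ?pa t" "act ?pa t = act ?pa y'"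
      using bridge_mem[OF pa y(2)] y True by auto
    have "a # z \<in> B" if "z \<in> bridge ?pa t" for z
      using that t(3) y True B by (auto simp: bridge_def)
    then show ?thesis
      by (rule level[of a y' "bridge ?pa t", rotated -1]) (use t Cons y in simp_all)
  next
    case False
    then have lev: "lev ?pa = Suc ?n" using ge lev_step[OF B(2) y(1)] by simp
    obtain u b v where uv: "y' = u @ b # v" "above (Suc ?n) ?pa u" "lev (act ?pa u) = Suc ?n"
      "lev (act ?pa (u @ [b])) = ?n"
      using first_descent[OF pa y(2), of ?n] lev y by auto
    have uvl: "u \<in> lists \<Sigma>" "b \<in> \<Sigma>" "v \<in> lists \<Sigma>" using y(2) uv by auto
    let ?q = "act ?pa (u @ [b])"
    have q: "?q \<in> V" using pa uvl by (intro act_closed) auto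
    obtain t where t: "bridge ?pa t \<in> bridges" "u \<in> bridge ?pa t" "act ?pa t = act ?pa u"
      using bridge_mem[OF pa uvl(1)] uv lev by auto
    obtain r where r: "bridge ?q r \<in> bridges" "v \<in> bridge ?q r" "act ?q r = act ?q v"
      using bridge_mem[OF q uvl(3)] uv y by (auto simp: above_append)
    have "a # z @ b # z' \<in> B" if "z \<in> bridge ?pa t" "z' \<in> bridge ?q r" for z z'
    proof -
      have z: "z \<in> lists \<Sigma>" "act ?pa z = act ?pa u" "above ?n ?pa z"
        using that(1) t(3) lev above_le[of "Suc ?n" ?pa z ?n] by (auto simp: bridge_def)
      have z': "z' \<in> lists \<Sigma>" "act ?q z' = act ?q v" "above ?n ?q z'"
        using that(2) r(3) uv by (auto simp: bridge_def)
      have "n \<le> lev (act ?pa z)" if "above n ?pa z" for n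
        using that aboveD[of n ?pa z "[]"] by simp
      then show ?thesis
        using z z' y uvl uv B ge by (auto simp: bridge_def above_append)
    qed
    then show ?thesis
      by (rule excursion[of a u b v "bridge ?pa t" "bridge ?q r", rotated -1]) (use t r uv uvl Cons y in simp_all)
  qed
qed (use Nil in blast)

definition first_return :: "'a list \<Rightarrow> bool" where
  "first_return z \<longleftrightarrow> z \<in> lists \<Sigma> \<and> z \<noteq> [] \<and> act base z = base \<and>
    (\<forall>u v. z = u @ v \<longrightarrow> u \<noteq> [] \<longrightarrow> v \<noteq> [] \<longrightarrow> act base u \<noteq> base)"

text \<open>The base point is the only vertex of level \<open>0\<close>, so the part of a first return strictly between its
  first and last letter is a bridge at level \<open>1\<close>.\<close>

lemma first_return_cases:
  assumes w: "w \<in> lists \<Sigma>" "w \<noteq> []" "act base w = base"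
  obtains (letter) a w' where "w = a # w'" "first_return [a]"
    | (bridge) a z b w' B where "w = a # z @ b # w'" "B \<in> bridges" "z \<in> B"
      "\<And>z. z \<in> B \<Longrightarrow> first_return (a # z @ [b])"
proof -
  obtain a w' where a: "w = a # w'" "a \<in> \<Sigma>" "w' \<in> lists \<Sigma>" using w by (cases w) auto
  let ?p = "step base a"
  have p: "?p \<in> V" using base_in a by (simp add: step_closed)
  show ?thesis
  proof (cases "?p = base")
    case True
    then have "first_return [a]" using a by (auto simp: first_return_def Cons_eq_append_conv)
    with a show ?thesis by (intro letter[of a w'])
  next
    case False
    then have lev: "lev ?p = 1"
      using lev_eq_0[OF p] lev_step[OF base_in a(2)] by simp
    obtain z b v where zv: "w' = z @ b # v" "above 1 ?p z" "lev (act ?p z) = 1" "lev (act ?p (z @ [b])) = 0"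
      using first_descent[OF p a(3), of 0] lev w a by auto
    have zl: "z \<in> lists \<Sigma>" "b \<in> \<Sigma>" using a zv by auto
    have "act ?p (z @ [b]) \<in> V" using p zl by (intro act_closed) auto
    then have ret: "step (act ?p z) b = base" using zv lev_eq_0 by simp
    obtain s where s: "bridge ?p s \<in> bridges" "z \<in> bridge ?p s" "act ?p s = act ?p z"
      using bridge_mem[OF p zl(1)] zv lev by auto
    have "first_return (a # y @ [b])" if "y \<in> bridge ?p s" for y
    proof -
      have y: "y \<in> lists \<Sigma>" "act ?p y = act ?p z" "above 1 ?p y"
        using that s lev by (auto simp: bridge_def)
      have "act base u \<noteq> base" if split: "a # y @ [b] = u @ v" "u \<noteq> []" "v \<noteq> []" for u v
      proof -
        obtain u' v' where u': "u = a # u'" "v = v' @ [b]" "y = u' @ v'"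
          using split by (cases u; cases v rule: rev_cases) auto
        then have "1 \<le> lev (act ?p u')" using aboveD y by auto
        then show ?thesis using u' by auto
      qed
      then show ?thesis
        using y ret a zl by (auto simp: first_return_def)
    qed
    then show ?thesis
      by (rule bridge[of a z b v "bridge ?p s", rotated -1]) (use s a zv in simp_all)
  qed
qed

end


section \<open>The grammar of the wreath product\<close>

text \<open>Letters \<open>Inr a\<close> move along an edge, letters \<open>Inl g\<close> do not move; \<open>visible step b x w\<close> collects the
  latter at those times when the walk from \<open>x\<close> along \<open>w\<close> is at \<open>b\<close>.\<close>

fun moves :: "('g + 'a) list \<Rightarrow> 'a list" where
  "moves [] = []"
| "moves (Inl g # w) = moves w"
| "moves (Inr a # w) = a # moves w"

lemma moves_append [simp]: "moves (u @ v) = moves u @ moves v"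
  by (induction u rule: moves.induct) auto

lemma moves_lists: "w \<in> lists (Inl ` \<Gamma> \<union> Inr ` \<Sigma>) \<Longrightarrow> moves w \<in> lists \<Sigma>"
  by (induction w rule: moves.induct) auto

lemma moves_eq_appendE:
  assumes "moves w = y @ b # z"
  obtains u v where "w = u @ Inr b # v" "moves u = y" "moves v = z"
proof -
  have "\<exists>u v. w = u @ Inr b # v \<and> moves u = y \<and> moves v = z"
    using assms
  proof (induction w arbitrary: y rule: moves.induct)
    case (2 g w)
    then obtain u v where "w = u @ Inr b # v" "moves u = y" "moves v = z" by auto
    then show ?case by (intro exI[of _ "Inl g # u"] exI[of _ v]) simp
  next
    case (3 a w)
    show ?case
    proof (cases y)
      case Nil
      then show ?thesis using 3 by (intro exI[of _ "[]"] exI[of _ w]) simp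
    next
      case (Cons c y')
      then obtain u v where "w = u @ Inr b # v" "moves u = y'" "moves v = z" using 3 by auto
      then show ?thesis using Cons 3 by (intro exI[of _ "Inr a # u"] exI[of _ v]) simp
    qed
  qed simp
  then show ?thesis using that by blast
qed

fun visible :: "('x \<Rightarrow> 'a \<Rightarrow> 'x) \<Rightarrow> 'x \<Rightarrow> 'x \<Rightarrow> ('g + 'a) list \<Rightarrow> 'g list" where
  "visible step b x [] = []"
| "visible step b x (Inl g # w) = (if x = b then g # visible step b x w else visible step b x w)"
| "visible step b x (Inr a # w) = visible step b (step x a) w"

lemma visible_append [simp]:
  "visible step b x (u @ v) = visible step b x u @ visible step b (foldl step x (moves u)) v"
  by (induction u arbitrary: x rule: moves.induct) auto

lemma visible_lists: "w \<in> lists (Inl ` \<Gamma> \<union> Inr ` \<Sigma>) \<Longrightarrow> visible step b x w \<in> lists \<Gamma>"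
  by (induction w arbitrary: x rule: moves.induct) auto

lemma visible_eq_Nil:
  "(\<And>u v. moves w = u @ v \<Longrightarrow> foldl step x u \<noteq> b) \<Longrightarrow> visible step b x w = []"
proof (induction w arbitrary: x rule: moves.induct)
  case (2 g w)
  have "visible step b x w = []"
    using 2 by auto
  moreover have "x \<noteq> b" using 2(2)[of "[]" "moves w"] by simp
  ultimately show ?case by simp
next
  case (3 a w)
  have "foldl step (step x a) u \<noteq> b" if "moves w = u @ v" for u v
    using 3(2)[of "a # u" v] that by simp
  then show ?case using 3(1) by simp
qed simp

lemma visible_eq_ConsE:
  assumes "visible step b x w = g # z"
  obtains u v where "w = u @ Inl g # v" "visible step b x u = []" "foldl step x (moves u) = b"
    "visible step b b v = z"
proof -
  have "\<exists>u v. w = u @ Inl g # v \<and> visible step b x u = [] \<and> foldl step x (moves u) = b \<and>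
    visible step b b v = z"
    using assms
  proof (induction w arbitrary: x rule: moves.induct)
    case (2 h w)
    show ?case
    proof (cases "x = b")
      case True
      then show ?thesis using 2 by (intro exI[of _ "[]"] exI[of _ w]) simp
    next
      case False
      then obtain u v where "w = u @ Inl g # v" "visible step b x u = []"
        "foldl step x (moves u) = b" "visible step b b v = z"
        using 2(1)[of x] 2(2) by auto
      then show ?thesis using False by (intro exI[of _ "Inl h # u"] exI[of _ v]) simp
    qed
  next
    case (3 a w)
    then obtain u v where "w = u @ Inl g # v" "visible step b (step x a) u = []"
      "foldl step (step x a) (moves u) = b" "visible step b b v = z"
      by fastforce
    then show ?case by (intro exI[of _ "Inr a # u"] exI[of _ v]) simp
  qed simp
  then show ?thesis using that by blast
qed

text \<open>\<open>Base A\<close> yields the loops at the base point whose visible letters spell a word of \<open>A\<close>, \<open>Pad\<close>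
  those without visible letters, and \<open>Far B\<close> the words that move along a bridge in \<open>B\<close>, with
  arbitrary letters \<open>Inl g\<close> interspersed.\<close>

datatype ('m, 'a) wreath_nonterminal = Start | Base 'm | Pad | Far "'a list set"

fun pad :: "('m + 'g) list \<Rightarrow> (('m, 'a) wreath_nonterminal + ('g + 'a)) list" where
  "pad [] = []"
| "pad (Inl A # \<beta>) = Inl (Base A) # pad \<beta>"
| "pad (Inr g # \<beta>) = Inl Pad # Inr (Inl g) # pad \<beta>"

locale wreath_words = context_free_action \<Sigma> bar V step base R S
  for \<Sigma> :: "'a set" and bar :: "'a \<Rightarrow> 'a" and V :: "'x set" and step :: "'x \<Rightarrow> 'a \<Rightarrow> 'x"
    and base :: 'x and R :: "('n \<times> ('n + 'a) list) set" and S :: 'n +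
  fixes \<Gamma> :: "'g set" and Q :: "('m \<times> ('m + 'g) list) set" and T :: 'm
  assumes finite_\<Gamma>: "finite \<Gamma>" and finite_Q: "finite Q"
    and Q_lists: "yields Q [Inl T] v \<Longrightarrow> v \<in> lists \<Gamma>"
begin

abbreviation vis :: "'x \<Rightarrow> ('g + 'a) list \<Rightarrow> 'g list" where
  "vis \<equiv> visible step base"

abbreviation letters :: "('g + 'a) set" where
  "letters \<equiv> Inl ` \<Gamma> \<union> Inr ` \<Sigma>"

definition base_rules where
  "base_rules = insert (Start, [Inl (Base T), Inl Pad]) ((\<lambda>(A, \<beta>). (Base A, pad \<beta>)) ` Q)"

text \<open>A rule belongs to the grammar as soon as it is valid for the languages involved. This makes
  soundness immediate, and leaves completeness to \<open>bridge_cases\<close> and \<open>first_return_cases\<close>.\<close>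

definition pad_rules where
  "pad_rules = {(Pad, [])} \<union>
    (\<lambda>a. (Pad, [Inr (Inr a), Inl Pad])) ` {a \<in> \<Sigma>. first_return [a]} \<union>
    (\<lambda>(a, B, b). (Pad, [Inr (Inr a), Inl (Far B), Inr (Inr b), Inl Pad])) `
      {(a, B, b) \<in> \<Sigma> \<times> bridges \<times> \<Sigma>. \<forall>z\<in>B. first_return (a # z @ [b])}"

definition far_rules where
  "far_rules =
    (\<lambda>B. (Far B, [])) ` {B \<in> bridges. [] \<in> B} \<union>
    (\<lambda>(B, g). (Far B, [Inr (Inl g), Inl (Far B)])) ` (bridges \<times> \<Gamma>) \<union>
    (\<lambda>(B, a, C). (Far B, [Inr (Inr a), Inl (Far C)])) `
      {(B, a, C) \<in> bridges \<times> \<Sigma> \<times> bridges. \<forall>z\<in>C. a # z \<in> B} \<union>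
    (\<lambda>(B, a, C, b, D). (Far B, [Inr (Inr a), Inl (Far C), Inr (Inr b), Inl (Far D)])) `
      {(B, a, C, b, D) \<in> bridges \<times> \<Sigma> \<times> bridges \<times> \<Sigma> \<times> bridges.
        \<forall>z\<in>C. \<forall>z'\<in>D. a # z @ b # z' \<in> B}"

definition rules :: "(('m, 'a) wreath_nonterminal \<times> (('m, 'a) wreath_nonterminal + ('g + 'a)) list) set" where
  "rules = base_rules \<union> pad_rules \<union> far_rules"

lemma finite_rules: "finite rules"
proof -
  have "finite {(a, B, b) \<in> \<Sigma> \<times> bridges \<times> \<Sigma>. P a B b}" for P
    by (rule finite_subset[of _ "\<Sigma> \<times> bridges \<times> \<Sigma>"]) (auto simp: finite_\<Sigma> finite_bridges)
  moreover have "finite {(B, a, C) \<in> bridges \<times> \<Sigma> \<times> bridges. P B a C}" for P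
    by (rule finite_subset[of _ "bridges \<times> \<Sigma> \<times> bridges"]) (auto simp: finite_\<Sigma> finite_bridges)
  moreover have "finite {(B, a, C, b, D) \<in> bridges \<times> \<Sigma> \<times> bridges \<times> \<Sigma> \<times> bridges. P B a C b D}" for P
    by (rule finite_subset[of _ "bridges \<times> \<Sigma> \<times> bridges \<times> \<Sigma> \<times> bridges"])
      (auto simp: finite_\<Sigma> finite_bridges)
  ultimately show ?thesis
    unfolding rules_def base_rules_def pad_rules_def far_rules_def
    using finite_\<Sigma> finite_Q finite_bridges finite_\<Gamma>
    by (intro finite_UnI finite_imageI finite.insertI finite.emptyI) simp_all
qed

text \<open>A nonterminal of \<open>Q\<close> that does not occur in the derivation of a word over \<open>\<Gamma>\<close> may involve letters
  outside \<open>\<Gamma>\<close>, whence the implication.\<close>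

fun meaning :: "('m, 'a) wreath_nonterminal \<Rightarrow> ('g + 'a) list set" where
  "meaning Start = {w. act base (moves w) = base \<and> yields Q [Inl T] (vis base w) \<and>
    (vis base w \<in> lists \<Gamma> \<longrightarrow> w \<in> lists letters)}"
| "meaning (Base A) = {w. act base (moves w) = base \<and> yields Q [Inl A] (vis base w) \<and>
    (vis base w \<in> lists \<Gamma> \<longrightarrow> w \<in> lists letters)}"
| "meaning Pad = {w \<in> lists letters. act base (moves w) = base \<and> vis base w = []}"
| "meaning (Far B) = {w \<in> lists letters. moves w \<in> B}"

lemma conc_pad:
  "conc meaning (pad \<beta>) \<subseteq> {w. act base (moves w) = base \<and> yields Q \<beta> (vis base w) \<and>
    (vis base w \<in> lists \<Gamma> \<longrightarrow> w \<in> lists letters)}"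
proof (induction \<beta> rule: pad.induct)
  case (2 A \<beta>)
  then show ?case by (fastforce intro: yields_Cons)
next
  case (3 g \<beta>)
  then show ?case by (fastforce intro: yields_Terminal)
qed (auto intro: yields_Nil)

lemma vis_far:
  assumes "first_return (a # moves w @ [b])"
  shows "vis (step base a) w = []"
proof (rule visible_eq_Nil)
  fix u v assume "moves w = u @ v"
  with assms have "act base (a # u) \<noteq> base"
    unfolding first_return_def by (auto simp del: foldl_Cons)
  then show "act (step base a) u \<noteq> base" by simp
qed

lemma rules_sound:
  assumes "(A, \<beta>) \<in> rules"
  shows "conc meaning \<beta> \<subseteq> meaning A"
proof -
  consider "(A, \<beta>) \<in> base_rules" | "(A, \<beta>) \<in> pad_rules" | "(A, \<beta>) \<in> far_rules"
    using assms by (auto simp: rules_def)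
  then show ?thesis
  proof cases
    case 1
    then consider "A = Start" "\<beta> = [Inl (Base T), Inl Pad]"
      | B \<gamma> where "(B, \<gamma>) \<in> Q" "A = Base B" "\<beta> = pad \<gamma>"
      by (auto simp: base_rules_def)
    then show ?thesis
    proof cases
      case 2
      then show ?thesis using conc_pad[of \<gamma>] yields_rule[of B \<gamma> Q] by fastforce
    qed auto
  next
    case 2
    then consider "A = Pad" "\<beta> = []"
      | a where "a \<in> \<Sigma>" "first_return [a]" "A = Pad" "\<beta> = [Inr (Inr a), Inl Pad]"
      | a B b where "a \<in> \<Sigma>" "b \<in> \<Sigma>" "\<forall>z\<in>B. first_return (a # z @ [b])" "A = Pad"
          "\<beta> = [Inr (Inr a), Inl (Far B), Inr (Inr b), Inl Pad]"
      by (auto simp: pad_rules_def)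
    then show ?thesis
    proof cases
      case 3
      have "Inr a # u @ Inr b # v \<in> meaning Pad" if "u \<in> meaning (Far B)" "v \<in> meaning Pad" for u v
      proof -
        have "first_return (a # moves u @ [b])" using 3 that by auto
        then have "vis (step base a) u = []" "step (act (step base a) (moves u)) b = base"
          using vis_far[of a u b] by (auto simp: first_return_def)
        with that 3 show ?thesis by simp
      qed
      then show ?thesis unfolding 3(4,5) by auto
    qed (auto simp: first_return_def)
  next
    case 3
    then show ?thesis by (auto simp: far_rules_def)
  qed
qed

lemma yields_far:
  "B \<in> bridges \<Longrightarrow> w \<in> lists letters \<Longrightarrow> moves w \<in> B \<Longrightarrow> yields rules [Inl (Far B)] w"
proof (induction w arbitrary: B rule: length_induct)
  case (1 w)
  note IH = 1(1)[rule_format] and B = 1(2)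
  show ?case
  proof (cases w)
    case Nil
    then have "(Far B, []) \<in> rules" using 1 by (auto simp: rules_def far_rules_def)
    then show ?thesis using Nil by (auto intro: yields_rule yields_Nil)
  next
    case (Cons s w')
    show ?thesis
    proof (cases s)
      case (Inl g)
      then have "(Far B, [Inr (Inl g), Inl (Far B)]) \<in> rules"
        using 1 Cons by (auto simp: rules_def far_rules_def)
      moreover have "yields rules [Inl (Far B)] w'"
        using 1 Cons Inl by (intro IH) auto
      ultimately show ?thesis
        unfolding Cons Inl by (blast intro: yields_rule yields_Terminal)
    next
      case (Inr a)
      from B 1(4) show ?thesis
      proof (cases rule: bridge_cases)
        case Nil
        then show ?thesis using Cons Inr by simp
      next
        case (level a' z C)
        then have a: "a' = a" "moves w' = z" using Cons Inr by auto
        have "(Far B, [Inr (Inr a), Inl (Far C)]) \<in> rules"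
          using B level(2,3,5) a unfolding rules_def far_rules_def
          by (intro UnI2 UnI1 image_eqI[of _ _ "(B, a, C)"]) simp_all
        moreover have "yields rules [Inl (Far C)] w'"
          using level(3,4) 1(3) a Cons by (intro IH) simp_all
        ultimately show ?thesis
          unfolding Cons Inr by (blast intro: yields_rule yields_Terminal)
      next
        case (excursion a' z b z' C D)
        then have "moves w' = z @ b # z'" "a' = a" using Cons Inr by auto
        then obtain u v where uv: "w' = u @ Inr b # v" "moves u = z" "moves v = z'"
          by (auto elim: moves_eq_appendE)
        have "(Far B, [Inr (Inr a), Inl (Far C), Inr (Inr b), Inl (Far D)]) \<in> rules"
          using B excursion(2-4,6,8) \<open>a' = a\<close> unfolding rules_def far_rules_def
          by (intro UnI2 image_eqI[of _ _ "(B, a, C, b, D)"]) simp_all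
        moreover have "yields rules [Inl (Far C)] u" "yields rules [Inl (Far D)] v"
          using excursion(4-7) 1(3) Cons uv by (simp_all add: IH)
        ultimately show ?thesis
          unfolding Cons Inr uv by (blast intro: yields_rule yields_Terminal yields_Cons)
      qed
    qed
  qed
qed

lemma yields_pad:
  "w \<in> lists letters \<Longrightarrow> act base (moves w) = base \<Longrightarrow> vis base w = [] \<Longrightarrow> yields rules [Inl Pad] w"
proof (induction w rule: length_induct)
  case (1 w)
  note IH = 1(1)[rule_format]
  have PadNil: "(Pad, []) \<in> rules" by (simp add: rules_def pad_rules_def)
  show ?case
  proof (cases w)
    case Nil
    then show ?thesis using PadNil by (auto intro: yields_rule yields_Nil)
  next
    case (Cons s w')
    then obtain a where s: "s = Inr a" using 1(4) by (cases s) auto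
    have "moves w \<in> lists \<Sigma>" "moves w \<noteq> []" using moves_lists[OF 1(2)] Cons s by auto
    then show ?thesis using 1(3)
    proof (cases rule: first_return_cases)
      case (letter a' y)
      then have a: "step base a = base" "a \<in> \<Sigma>" "a' = a" using Cons s by (auto simp: first_return_def)
      then have "(Pad, [Inr (Inr a), Inl Pad]) \<in> rules"
        using letter by (auto simp: rules_def pad_rules_def)
      moreover have "yields rules [Inl Pad] w'"
        using 1 Cons s a by (intro IH) auto
      ultimately show ?thesis
        unfolding Cons s by (blast intro: yields_rule yields_Terminal)
    next
      case (bridge a' z b y B)
      then have "moves w' = z @ b # y" "a' = a" using Cons s by auto
      then obtain u v where uv: "w' = u @ Inr b # v" "moves u = z" "moves v = y"
        by (auto elim: moves_eq_appendE)
      have ret: "step (act (step base a) z) b = base" "a \<in> \<Sigma>" "b \<in> \<Sigma>"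
        using bridge(4)[OF bridge(3)] \<open>a' = a\<close> unfolding first_return_def by simp_all
      have "(Pad, [Inr (Inr a), Inl (Far B), Inr (Inr b), Inl Pad]) \<in> rules"
        using bridge(2,4) ret \<open>a' = a\<close> unfolding rules_def pad_rules_def
        by (intro UnI1 UnI2 image_eqI[of _ _ "(a, B, b)"]) simp_all
      moreover have "yields rules [Inl (Far B)] u"
        using bridge(2,3) 1(2) Cons uv by (intro yields_far) simp_all
      moreover have "yields rules [Inl Pad] v"
        using 1(2-4) Cons s uv ret by (intro IH) simp_all
      ultimately show ?thesis
        unfolding Cons s uv by (blast intro: yields_rule yields_Terminal yields_Cons)
    qed
  qed
qed

text \<open>Padding precedes each visible letter, so the loop at the end of \<open>w\<close> that follows the last visible
  letter of \<open>y\<close> is not consumed here. It is left for \<open>v\<close>, and finally for the \<open>Pad\<close> in the rule for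
  \<open>Start\<close>.\<close>

lemma yields_base:
  assumes "yields Q \<beta> y" "w \<in> lists letters" "act base (moves w) = base" "vis base w = y @ z"
  shows "\<exists>u v. w = u @ v \<and> yields rules (pad \<beta>) u \<and> act base (moves v) = base \<and> vis base v = z"
  using assms
proof (induction arbitrary: w z rule: yields.induct)
  case yields_Nil
  then show ?case by (intro exI[of _ "[]"] exI[of _ w]) (auto intro: yields.yields_Nil)
next
  case (yields_Terminal \<beta> y g)
  have "vis base w = g # y @ z" using yields_Terminal.prems by simp
  then obtain u v where uv: "w = u @ Inl g # v" "vis base u = []" "act base (moves u) = base"
    "vis base v = y @ z"
    by (rule visible_eq_ConsE)
  then obtain v1 v2 where v: "v = v1 @ v2" "yields rules (pad \<beta>) v1" "act base (moves v2) = base"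
    "vis base v2 = z"
    using yields_Terminal.IH[of v z] yields_Terminal.prems by auto
  have "yields rules [Inl Pad] u"
    using uv yields_Terminal.prems by (intro yields_pad) auto
  then have "yields rules (pad (Inr g # \<beta>)) (u @ Inl g # v1)"
    using v(2) by (auto intro: yields_Cons yields.yields_Terminal)
  then show ?case using uv v by (intro exI[of _ "u @ Inl g # v1"] exI[of _ v2]) auto
next
  case (yields_Nonterminal A \<gamma> y1 \<beta> y2)
  have "vis base w = y1 @ y2 @ z" using yields_Nonterminal.prems by simp
  then obtain u v where uv: "w = u @ v" "yields rules (pad \<gamma>) u" "act base (moves v) = base"
    "vis base v = y2 @ z"
    using yields_Nonterminal.IH(1)[OF yields_Nonterminal.prems(1,2)] by auto
  then obtain v1 v2 where v: "v = v1 @ v2" "yields rules (pad \<beta>) v1" "act base (moves v2) = base"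
    "vis base v2 = z"
    using yields_Nonterminal.IH(2)[of v z] yields_Nonterminal.prems by auto
  have "(Base A, pad \<gamma>) \<in> rules"
    using yields_Nonterminal.hyps(1) by (force simp: rules_def base_rules_def)
  then have "yields rules (pad (Inl A # \<beta>)) (u @ v1)"
    using uv v by (auto intro: yields_Cons yields_rule)
  then show ?case using uv v by (intro exI[of _ "u @ v1"] exI[of _ v2]) auto
qed

theorem yields_wreath_iff:
  "yields rules [Inl Start] w \<longleftrightarrow>
    w \<in> lists letters \<and> act base (moves w) = base \<and> yields Q [Inl T] (vis base w)"
proof
  assume "yields rules [Inl Start] w"
  then have "w \<in> conc meaning [Inl Start]"
    by (rule yields_sound) (rule rules_sound)
  then have "w \<in> meaning Start" by auto
  then show "w \<in> lists letters \<and> act base (moves w) = base \<and> yields Q [Inl T] (vis base w)"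
    using Q_lists by auto
next
  assume w: "w \<in> lists letters \<and> act base (moves w) = base \<and> yields Q [Inl T] (vis base w)"
  then obtain u v where uv: "w = u @ v" "yields rules (pad [Inl T]) u" "act base (moves v) = base"
    "vis base v = []"
    using yields_base[of "[Inl T]" "vis base w" w "[]"] by auto
  have "yields rules [Inl Pad] v" using uv w by (intro yields_pad) auto
  moreover have "yields rules [Inl (Base T)] u" using uv(2) by simp
  moreover have "(Start, [Inl (Base T), Inl Pad]) \<in> rules" by (simp add: rules_def base_rules_def)
  ultimately show "yields rules [Inl Start] w"
    unfolding uv(1) by (blast intro: yields_rule yields_Cons)
qed

end


section \<open>Words that represent group elements\<close>

definition word_value :: "('k, 'm) monoid_scheme \<Rightarrow> ('s \<Rightarrow> 'k) \<Rightarrow> 's list \<Rightarrow> 'k" where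
  "word_value K val w = foldr (\<lambda>s k. val s \<otimes>\<^bsub>K\<^esub> k) w \<one>\<^bsub>K\<^esub>"

lemma word_value_simps [simp]:
  "word_value K val [] = \<one>\<^bsub>K\<^esub>"
  "word_value K val (s # w) = val s \<otimes>\<^bsub>K\<^esub> word_value K val w"
  by (simp_all add: word_value_def)

lemma word_bar_simps [simp]: "word_bar bar [] = []" "word_bar bar (s # w) = word_bar bar w @ [bar s]"
  by (simp_all add: word_bar_def)

context group
begin

lemma word_value_closed: "val \<in> \<Sigma> \<rightarrow> carrier G \<Longrightarrow> w \<in> lists \<Sigma> \<Longrightarrow> word_value G val w \<in> carrier G"
  by (induction w) auto

lemma word_value_append:
  "val \<in> \<Sigma> \<rightarrow> carrier G \<Longrightarrow> u \<in> lists \<Sigma> \<Longrightarrow> v \<in> lists \<Sigma> \<Longrightarrow>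
    word_value G val (u @ v) = word_value G val u \<otimes> word_value G val v"
proof (induction u)
  case Nil
  then show ?case using word_value_closed[of val \<Sigma> v] by simp
next
  case (Cons s u)
  then have "s \<in> \<Sigma>" "u \<in> lists \<Sigma>" by auto
  then show ?case
    using Cons word_value_closed[of val \<Sigma> u] word_value_closed[of val \<Sigma> v]
    by (simp add: m_assoc Pi_iff)
qed

lemma word_value_word_bar:
  assumes "val \<in> \<Sigma> \<rightarrow> carrier G" "\<And>s. s \<in> \<Sigma> \<Longrightarrow> bar s \<in> \<Sigma> \<and> val (bar s) = inv (val s)"
  shows "w \<in> lists \<Sigma> \<Longrightarrow> word_value G val (word_bar bar w) = inv (word_value G val w)"
proof (induction w)
  case (Cons s w)
  then have "s \<in> \<Sigma>" "w \<in> lists \<Sigma>" by auto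
  moreover have "word_bar bar w \<in> lists \<Sigma>"
    using assms \<open>w \<in> lists \<Sigma>\<close> by (intro word_bar_lists) auto
  ultimately show ?case
    using Cons assms word_value_closed[OF assms(1), of w] word_value_append[OF assms(1), of "word_bar bar w" "[bar s]"]
    by (auto simp: inv_mult_group Pi_iff)
qed simp

lemma word_value_generate: "w \<in> lists \<Sigma> \<Longrightarrow> word_value G val w \<in> generate G (val ` \<Sigma>)"
  by (induction w) (auto intro: generate.one generate.eng generate.incl)

text \<open>A finite alphabet of any type can be renamed to natural numbers.\<close>

lemma context_free_subgroupI:
  fixes R :: "('n \<times> ('n + 's) list) set"
  assumes K': "subgroup K' G"
    and \<Sigma>: "symmetric_alphabet \<Sigma> bar"
    and val: "val \<in> \<Sigma> \<rightarrow> carrier G" "\<And>s. s \<in> \<Sigma> \<Longrightarrow> val (bar s) = inv (val s)"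
    and surj: "\<And>k. k \<in> carrier G \<Longrightarrow> \<exists>w\<in>lists \<Sigma>. word_value G val w = k"
    and R: "finite R" "\<And>w. yields R [Inl S] w \<longleftrightarrow> w \<in> lists \<Sigma> \<and> word_value G val w \<in> K'"
  shows "context_free_subgroup G K'"
proof -
  have fin: "finite \<Sigma>" and bar: "\<And>s. s \<in> \<Sigma> \<Longrightarrow> bar s \<in> \<Sigma> \<and> bar (bar s) = s"
    using \<Sigma> by (auto simp: symmetric_alphabet_def)
  obtain f :: "'s \<Rightarrow> nat" where f: "inj_on f \<Sigma>"
    using fin finite_imp_inj_to_nat_seg by blast
  define g where "g = inv_into \<Sigma> f"
  have gf: "g (f s) = s" if "s \<in> \<Sigma>" for s
    using f that by (simp add: g_def)
  define \<rho> where "\<rho> = word_value G (val \<circ> g)"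
  have \<rho>_map: "\<rho> (map f w) = word_value G val w" if "w \<in> lists \<Sigma>" for w
    using that by (induction w) (auto simp: \<rho>_def gf)
  have lists: "lists (f ` \<Sigma>) = map f ` lists \<Sigma>"
    by (simp add: lists_image)
  let ?bar = "f \<circ> bar \<circ> g"
  have val': "val \<circ> g \<in> f ` \<Sigma> \<rightarrow> carrier G"
    using val gf by auto
  have "symmetric_alphabet (f ` \<Sigma>) ?bar"
    using fin bar gf by (auto simp: symmetric_alphabet_def)
  moreover have "symmetric_epimorphism (f ` \<Sigma>) ?bar G \<rho>"
    unfolding symmetric_epimorphism_def
  proof (intro conjI ballI)
    show "\<rho> \<in> hom (free_monoid (f ` \<Sigma>)) G"
      using val' by (auto intro!: homI simp: free_monoid_def \<rho>_def word_value_append word_value_closed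
          simp del: lists_image)
    show "\<rho> (word_bar ?bar w) = inv \<rho> w" if "w \<in> lists (f ` \<Sigma>)" for w
      unfolding \<rho>_def using that val val' bar gf by (intro word_value_word_bar) auto
    have "\<rho> ` lists (f ` \<Sigma>) = word_value G val ` lists \<Sigma>"
      unfolding lists image_image using \<rho>_map by (intro image_cong) auto
    also have "\<dots> = carrier G"
      using surj word_value_closed[OF val(1)] by blast
    finally show "\<rho> ` lists (f ` \<Sigma>) = carrier G" .
  qed (simp add: \<rho>_def)
  moreover have "membership_problem (f ` \<Sigma>) \<rho> K' = map f ` {w. yields R [Inl S] w}"
  proof -
    have "membership_problem (f ` \<Sigma>) \<rho> K' = map f ` {w \<in> lists \<Sigma>. \<rho> (map f w) \<in> K'}"
      unfolding membership_problem_def lists by auto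
    then show ?thesis unfolding R(2) by (simp add: \<rho>_map cong: conj_cong)
  qed
  then have "context_free_language (membership_problem (f ` \<Sigma>) \<rho> K')"
    using context_free_language_map_yields[OF R(1)] by metis
  moreover have "generate G (val ` \<Sigma>) = carrier G"
  proof
    show "generate G (val ` \<Sigma>) \<subseteq> carrier G"
      using val(1) by (intro generate_incl image_subsetI) (rule funcset_mem)
    show "carrier G \<subseteq> generate G (val ` \<Sigma>)"
    proof
      fix k assume "k \<in> carrier G"
      then obtain w where "w \<in> lists \<Sigma>" "word_value G val w = k" using surj by blast
      then show "k \<in> generate G (val ` \<Sigma>)" using word_value_generate[of w \<Sigma> val] by simp
    qed
  qed
  then have "finitely_generated G"
    unfolding finitely_generated_def using fin val(1) by (intro exI[of _ "val ` \<Sigma>"]) auto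
  ultimately show ?thesis
    unfolding context_free_subgroup_def using K' is_group by blast
qed

end

locale group_presentation = group G for G (structure) +
  fixes \<Sigma> :: "'s set" and bar :: "'s \<Rightarrow> 's" and \<rho> :: "'s list \<Rightarrow> 'a"
  assumes alphabet: "symmetric_alphabet \<Sigma> bar" and epi: "symmetric_epimorphism \<Sigma> bar G \<rho>"
begin

lemma finite_alphabet: "finite \<Sigma>" and bar_closed: "s \<in> \<Sigma> \<Longrightarrow> bar s \<in> \<Sigma>"
  using alphabet by (auto simp: symmetric_alphabet_def)

lemma \<rho>_Nil [simp]: "\<rho> [] = \<one>"
  using epi by (simp add: symmetric_epimorphism_def)

lemma \<rho>_closed: "w \<in> lists \<Sigma> \<Longrightarrow> \<rho> w \<in> carrier G"
  using epi by (auto simp: symmetric_epimorphism_def)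

lemma \<rho>_append: "u \<in> lists \<Sigma> \<Longrightarrow> v \<in> lists \<Sigma> \<Longrightarrow> \<rho> (u @ v) = \<rho> u \<otimes> \<rho> v"
  using epi hom_mult[of \<rho> "free_monoid \<Sigma>" G u v] by (simp add: symmetric_epimorphism_def free_monoid_def)

lemma \<rho>_Cons: "s \<in> \<Sigma> \<Longrightarrow> w \<in> lists \<Sigma> \<Longrightarrow> \<rho> (s # w) = \<rho> [s] \<otimes> \<rho> w"
  using \<rho>_append[of "[s]" w] by simp

lemma \<rho>_bar: "s \<in> \<Sigma> \<Longrightarrow> \<rho> [bar s] = inv (\<rho> [s])"
  using epi by (force simp: symmetric_epimorphism_def dest: bspec[of _ _ "[s]"])

lemma \<rho>_surj: "x \<in> carrier G \<Longrightarrow> \<exists>w\<in>lists \<Sigma>. \<rho> w = x"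
  using epi by (force simp: symmetric_epimorphism_def)

end

lemma context_free_subgroup_presentation:
  assumes "context_free_subgroup G K'"
  obtains \<Sigma> :: "nat set" and bar \<rho> and R :: "(nat \<times> (nat + nat) list) set" and S
  where "group_presentation G \<Sigma> bar \<rho>" "subgroup K' G" "finite R"
    "\<And>w. yields R [Inl S] w \<longleftrightarrow> w \<in> lists \<Sigma> \<and> \<rho> w \<in> K'"
proof -
  obtain \<Sigma> :: "nat set" and bar \<rho> where *: "group G" "subgroup K' G" "symmetric_alphabet \<Sigma> bar"
    "symmetric_epimorphism \<Sigma> bar G \<rho>" "context_free_language (membership_problem \<Sigma> \<rho> K')"
    using assms by (auto simp: context_free_subgroup_def)
  from *(5) obtain R :: "(nat \<times> (nat + nat) list) set" and S
    where R: "finite R" "\<And>w. w \<in> membership_problem \<Sigma> \<rho> K' \<longleftrightarrow> yields R [Inl S] w"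
    by (rule context_free_language_yields) blast
  show ?thesis
  proof (rule that)
    show "group_presentation G \<Sigma> bar \<rho>"
      using * by (simp add: group_presentation_def group_presentation_axioms_def)
    show "yields R [Inl S] w \<longleftrightarrow> w \<in> lists \<Sigma> \<and> \<rho> w \<in> K'" for w
      using R(2)[of w] by (simp add: membership_problem_def)
  qed (fact * R)+
qed


section \<open>Generators of the wreath product and the Schreier graph\<close>

lemma subgroup_gen_wreath:
  assumes G: "group G" and H: "group H" and G': "subgroup G' G" and H': "subgroup H' H"
  shows "subgroup (gen_wreath_subgroup G G' H H') (gen_wreath G H H')"
proof -
  let ?W = "gen_wreath G H H'" and ?N = "wreath_base G H H'"
  interpret G: group G by (rule G)
  interpret H: group H by (rule H)
  interpret W: group ?W using G H H' by (rule group_gen_wreath)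
  have H'_coset: "H' \<in> rcosets\<^bsub>H\<^esub> H'"
    using H.coset_mult_one[OF subgroup.subset[OF H']] H.rcosetsI[OF subgroup.subset[OF H'] H.one_closed] by simp
  have fix_coset: "H' #>\<^bsub>H\<^esub> h = H'" if "h \<in> H'" for h
    using H.coset_join2[OF _ H' that] subgroup.mem_carrier[OF H' that] by simp
  have mem: "x \<in> gen_wreath_subgroup G G' H H' \<longleftrightarrow>
      x \<in> carrier ?W \<and> fst x H' \<in> G' \<and> snd x \<in> H'" for x
    using subgroup.mem_carrier[OF H']
    by (cases x) (auto simp: gen_wreath_subgroup_def gen_wreath_def)
  have comp: "fst (x \<otimes>\<^bsub>?W\<^esub> y) H' = fst x H' \<otimes>\<^bsub>G\<^esub> fst y H'" "snd (x \<otimes>\<^bsub>?W\<^esub> y) = snd x \<otimes>\<^bsub>H\<^esub> snd y"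
    if "snd x \<in> H'" for x y
    using H'_coset fix_coset[OF that] subgroup.mem_carrier[OF H' that]
    by (cases x; cases y; simp add: gen_wreath_def wreath_conj_def)+
  have val: "fst x H' \<in> carrier G" "snd x \<in> carrier H" if "x \<in> carrier ?W" for x
    using that H'_coset by (auto simp: gen_wreath_def carrier_wreath_base[OF G H H'])
  have one: "fst \<one>\<^bsub>?W\<^esub> H' = \<one>\<^bsub>G\<^esub>" "snd \<one>\<^bsub>?W\<^esub> = \<one>\<^bsub>H\<^esub>"
    using H'_coset by (simp_all add: gen_wreath_def)
  show ?thesis
  proof (rule W.subgroupI)
    show "gen_wreath_subgroup G G' H H' \<subseteq> carrier ?W" by (auto simp: mem)
    show "gen_wreath_subgroup G G' H H' \<noteq> {}"
      using mem[of "\<one>\<^bsub>?W\<^esub>"] one subgroup.one_closed[OF G'] subgroup.one_closed[OF H'] by auto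
    show "x \<otimes>\<^bsub>?W\<^esub> y \<in> gen_wreath_subgroup G G' H H'"
      if "x \<in> gen_wreath_subgroup G G' H H'" "y \<in> gen_wreath_subgroup G G' H H'" for x y
      using that subgroup.m_closed[OF G'] subgroup.m_closed[OF H'] by (auto simp: mem comp)
    show "inv\<^bsub>?W\<^esub> x \<in> gen_wreath_subgroup G G' H H'" if "x \<in> gen_wreath_subgroup G G' H H'" for x
    proof -
      let ?y = "inv\<^bsub>?W\<^esub> x"
      have x: "x \<in> carrier ?W" "fst x H' \<in> G'" "snd x \<in> H'" using that by (auto simp: mem)
      have y: "?y \<in> carrier ?W" "x \<otimes>\<^bsub>?W\<^esub> ?y = \<one>\<^bsub>?W\<^esub>" using x(1) by auto
      have "snd x \<otimes>\<^bsub>H\<^esub> snd ?y = \<one>\<^bsub>H\<^esub>" "fst x H' \<otimes>\<^bsub>G\<^esub> fst ?y H' = \<one>\<^bsub>G\<^esub>"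
        using comp[OF x(3), of ?y] y(2) one by simp_all
      then have "snd ?y = inv\<^bsub>H\<^esub> snd x" "fst ?y H' = inv\<^bsub>G\<^esub> fst x H'"
        using val[OF x(1)] val[OF y(1)] by (metis H.inv_equality H.inv_comm, metis G.inv_equality G.inv_comm)
      then show ?thesis
        using x y(1) subgroup.m_inv_closed[OF G'] subgroup.m_inv_closed[OF H'] by (simp add: mem)
    qed
  qed
qed

lemma schreier_context_free_action:
  assumes "group_presentation H \<Sigma> bar \<rho>" and H': "subgroup H' H"
    and R: "finite R" "\<And>w. yields R [Inl S] w \<longleftrightarrow> w \<in> lists \<Sigma> \<and> \<rho> w \<in> H'"
  shows "context_free_action \<Sigma> bar (rcosets\<^bsub>H\<^esub> H') (\<lambda>C a. C #>\<^bsub>H\<^esub> \<rho> [a]) H' R S"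
    and "C \<in> rcosets\<^bsub>H\<^esub> H' \<Longrightarrow> w \<in> lists \<Sigma> \<Longrightarrow> foldl (\<lambda>C a. C #>\<^bsub>H\<^esub> \<rho> [a]) C w = C #>\<^bsub>H\<^esub> \<rho> w"
proof -
  interpret H: group_presentation H \<Sigma> bar \<rho> by fact
  note H = H.is_group
  let ?step = "\<lambda>C a. C #>\<^bsub>H\<^esub> \<rho> [a]"
  have act: "foldl ?step C w = C #>\<^bsub>H\<^esub> \<rho> w" if "C \<in> rcosets\<^bsub>H\<^esub> H'" "w \<in> lists \<Sigma>" for C w
    using that(2,1)
  proof (induction w arbitrary: C)
    case Nil
    then show ?case by (simp add: rcoset_mult_one[OF H H H'])
  next
    case (Cons s w)
    then show ?case
      using H.\<rho>_Cons[of s w] H.\<rho>_closed[of "[s]"] H.\<rho>_closed[of w]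
      by (simp add: rcoset_mult_closed[OF H H H'] rcoset_mult_assoc[OF H H H'])
  qed
  then show "C \<in> rcosets\<^bsub>H\<^esub> H' \<Longrightarrow> w \<in> lists \<Sigma> \<Longrightarrow> foldl ?step C w = C #>\<^bsub>H\<^esub> \<rho> w" .
  have H'_coset: "H' \<in> rcosets\<^bsub>H\<^esub> H'"
    using H.coset_mult_one[OF subgroup.subset[OF H']] H.rcosetsI[OF subgroup.subset[OF H'] H.one_closed] by simp
  show "context_free_action \<Sigma> bar (rcosets\<^bsub>H\<^esub> H') ?step H' R S"
  proof
    show "finite \<Sigma>" by (rule H.finite_alphabet)
    show "bar a \<in> \<Sigma>" if "a \<in> \<Sigma>" for a using that by (rule H.bar_closed)
    show "C #>\<^bsub>H\<^esub> \<rho> [a] \<in> rcosets\<^bsub>H\<^esub> H'" if "C \<in> rcosets\<^bsub>H\<^esub> H'" "a \<in> \<Sigma>" for C a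
      using that H.\<rho>_closed[of "[a]"] by (simp add: rcoset_mult_closed[OF H H H'])
    show "C #>\<^bsub>H\<^esub> \<rho> [a] #>\<^bsub>H\<^esub> \<rho> [bar a] = C" if "C \<in> rcosets\<^bsub>H\<^esub> H'" "a \<in> \<Sigma>" for C a
      using that H.\<rho>_closed[of "[a]"]
      by (simp add: H.\<rho>_bar rcoset_mult_assoc[OF H H H'] rcoset_mult_one[OF H H H'])
    show "H' \<in> rcosets\<^bsub>H\<^esub> H'" by (rule H'_coset)
    show "\<exists>w\<in>lists \<Sigma>. foldl ?step H' w = C" if C: "C \<in> rcosets\<^bsub>H\<^esub> H'" for C
    proof -
      obtain h where h: "h \<in> carrier H" "C = H' #>\<^bsub>H\<^esub> h"
        using C by (auto simp: RCOSETS_def)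
      obtain w where "w \<in> lists \<Sigma>" "\<rho> w = h" using H.\<rho>_surj[OF h(1)] by blast
      then show ?thesis using act[OF H'_coset] h by auto
    qed
    show "finite R" by (rule R(1))
    fix w
    have "H' #>\<^bsub>H\<^esub> \<rho> w = H' \<longleftrightarrow> \<rho> w \<in> H'" if "w \<in> lists \<Sigma>"
      using H.coset_join1[OF _ H.\<rho>_closed[OF that] H'] H.coset_join2[OF H.\<rho>_closed[OF that] H']
        subgroup.subset[OF H'] by blast
    then show "w \<in> lists \<Sigma> \<and> foldl ?step H' w = H' \<longleftrightarrow> yields R [Inl S] w"
      using act[OF H'_coset] R(2) by auto
  qed
qed

locale wreath_presentation =
  G: group_presentation G \<Gamma> bar\<^sub>G \<rho>\<^sub>G + H: group_presentation H \<Sigma> bar\<^sub>H \<rho>\<^sub>H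
  for G :: "('g, 'm) monoid_scheme" and \<Gamma> :: "'t set" and bar\<^sub>G \<rho>\<^sub>G
    and H :: "('h, 'n) monoid_scheme" and \<Sigma> :: "'s set" and bar\<^sub>H \<rho>\<^sub>H +
  fixes H' :: "'h set"
  assumes H': "subgroup H' H"
begin

abbreviation W where "W \<equiv> gen_wreath G H H'"

abbreviation cosets where "cosets \<equiv> rcosets\<^bsub>H\<^esub> H'"

abbreviation step where "step \<equiv> \<lambda>C a. C #>\<^bsub>H\<^esub> \<rho>\<^sub>H [a]"

abbreviation letters :: "('t + 's) set" where
  "letters \<equiv> Inl ` \<Gamma> \<union> Inr ` \<Sigma>"

definition at_coset :: "'h set \<Rightarrow> 'g \<Rightarrow> 'h set \<Rightarrow> 'g" where
  "at_coset C x = (\<lambda>D\<in>cosets. if D = C then x else \<one>\<^bsub>G\<^esub>)"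

fun val :: "'t + 's \<Rightarrow> ('h set \<Rightarrow> 'g) \<times> 'h" where
  "val (Inl g) = (at_coset H' (\<rho>\<^sub>G [g]), \<one>\<^bsub>H\<^esub>)"
| "val (Inr a) = (\<one>\<^bsub>wreath_base G H H'\<^esub>, \<rho>\<^sub>H [a])"

lemmas group_W = group_gen_wreath[OF G.is_group H.is_group H']
lemmas carrier_base = carrier_wreath_base[OF G.is_group H.is_group H']
lemmas coset_closed = rcoset_mult_closed[OF H.is_group H.is_group H']
lemmas coset_assoc = rcoset_mult_assoc[OF H.is_group H.is_group H']
lemmas coset_one = rcoset_mult_one[OF H.is_group H.is_group H']

sublocale W: group W by (rule group_W)

lemma H'_coset: "H' \<in> cosets"
  using H.coset_mult_one[OF subgroup.subset[OF H']] H.rcosetsI[OF subgroup.subset[OF H'] H.one_closed] by simp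

lemma at_coset_closed: "x \<in> carrier G \<Longrightarrow> at_coset C x \<in> carrier (wreath_base G H H')"
  unfolding carrier_base at_coset_def
  by (auto intro: finite_subset[of _ "{C}"])

lemma one_base_closed: "\<one>\<^bsub>wreath_base G H H'\<^esub> \<in> carrier (wreath_base G H H')"
  by (auto simp: carrier_base)

lemma val_closed: "val \<in> letters \<rightarrow> carrier W"
  using G.\<rho>_closed[of "[_]"] H.\<rho>_closed[of "[_]"]
  by (auto simp: gen_wreath_def at_coset_closed one_base_closed simp del: one_sum_group)

lemma base_mult: "(f, \<one>\<^bsub>H\<^esub>) \<otimes>\<^bsub>W\<^esub> (f', h) = ((\<lambda>C\<in>cosets. f C \<otimes>\<^bsub>G\<^esub> f' C), h)" if "h \<in> carrier H" for f f' h
  using that by (auto simp: gen_wreath_def wreath_conj_def coset_one intro!: restrict_ext)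

lemma top_mult: "(\<one>\<^bsub>wreath_base G H H'\<^esub>, k) \<otimes>\<^bsub>W\<^esub> ((\<lambda>C\<in>cosets. F C), h) =
    ((\<lambda>C\<in>cosets. F (C #>\<^bsub>H\<^esub> k)), k \<otimes>\<^bsub>H\<^esub> h)"
  if "k \<in> carrier H" "\<And>C. C \<in> cosets \<Longrightarrow> F C \<in> carrier G" for F h k
  using that by (auto simp: gen_wreath_def wreath_conj_def coset_closed intro!: restrict_ext)

text \<open>The component at any coset \<open>C\<close>, not only at the trivial one, is needed for the induction: removing
  a first letter from \<open>H\<close> moves the coset.\<close>

lemma word_value_wreath:
  "w \<in> lists letters \<Longrightarrow>
    word_value W val w = ((\<lambda>C\<in>cosets. \<rho>\<^sub>G (visible step H' C w)), \<rho>\<^sub>H (moves w))"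
proof (induction w rule: moves.induct)
  case 1
  then show ?case by (auto simp: gen_wreath_def intro!: restrict_ext)
next
  case (2 g w)
  then have w: "g \<in> \<Gamma>" "w \<in> lists letters" by auto
  have "word_value W val (Inl g # w) = (at_coset H' (\<rho>\<^sub>G [g]), \<one>\<^bsub>H\<^esub>) \<otimes>\<^bsub>W\<^esub>
      ((\<lambda>C\<in>cosets. \<rho>\<^sub>G (visible step H' C w)), \<rho>\<^sub>H (moves w))"
    unfolding word_value_simps val.simps 2(1)[OF w(2)] ..
  also have "\<dots> = ((\<lambda>C\<in>cosets. at_coset H' (\<rho>\<^sub>G [g]) C \<otimes>\<^bsub>G\<^esub>
      (\<lambda>C\<in>cosets. \<rho>\<^sub>G (visible step H' C w)) C), \<rho>\<^sub>H (moves w))"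
    by (rule base_mult) (use w in \<open>intro H.\<rho>_closed moves_lists\<close>)
  also have "\<dots> = ((\<lambda>C\<in>cosets. \<rho>\<^sub>G (visible step H' C (Inl g # w))), \<rho>\<^sub>H (moves w))"
  proof (intro arg_cong2[of _ _ _ _ Pair] restrict_ext refl)
    fix C assume "C \<in> cosets"
    then show "at_coset H' (\<rho>\<^sub>G [g]) C \<otimes>\<^bsub>G\<^esub> (\<lambda>C\<in>cosets. \<rho>\<^sub>G (visible step H' C w)) C =
        \<rho>\<^sub>G (visible step H' C (Inl g # w))"
      using G.\<rho>_Cons[OF w(1) visible_lists[OF w(2), of step H' C]]
        G.\<rho>_closed[OF visible_lists[OF w(2), of step H' C]]
      by (auto simp: at_coset_def)
  qed
  finally show ?case unfolding moves.simps .
next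
  case (3 a w)
  then have w: "a \<in> \<Sigma>" "w \<in> lists letters" by auto
  have "word_value W val (Inr a # w) = (\<one>\<^bsub>wreath_base G H H'\<^esub>, \<rho>\<^sub>H [a]) \<otimes>\<^bsub>W\<^esub>
      ((\<lambda>C\<in>cosets. \<rho>\<^sub>G (visible step H' C w)), \<rho>\<^sub>H (moves w))"
    unfolding word_value_simps val.simps 3(1)[OF w(2)] ..
  also have "\<dots> = ((\<lambda>C\<in>cosets. \<rho>\<^sub>G (visible step H' (C #>\<^bsub>H\<^esub> \<rho>\<^sub>H [a]) w)), \<rho>\<^sub>H [a] \<otimes>\<^bsub>H\<^esub> \<rho>\<^sub>H (moves w))"
    by (rule top_mult) (use w in \<open>simp_all add: H.\<rho>_closed G.\<rho>_closed visible_lists\<close>)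
  finally show ?case unfolding moves.simps visible.simps H.\<rho>_Cons[OF w(1) moves_lists[OF w(2)]] .
qed

lemma word_value_moves:
  "w \<in> lists \<Sigma> \<Longrightarrow> word_value W val (map Inr w) = (\<one>\<^bsub>wreath_base G H H'\<^esub>, \<rho>\<^sub>H w)"
proof -
  assume w: "w \<in> lists \<Sigma>"
  define v :: "('t + 's) list" where "v = map Inr w"
  have "visible step H' C v = []" for C
    unfolding v_def by (induction w arbitrary: C) auto
  moreover have "moves v = w" unfolding v_def by (induction w) auto
  moreover have "v \<in> lists letters" using w by (auto simp: v_def)
  ultimately have "word_value W val v = (\<one>\<^bsub>wreath_base G H H'\<^esub>, \<rho>\<^sub>H w)"
    by (auto simp: word_value_wreath intro!: restrict_ext)
  then show ?thesis by (simp add: v_def)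
qed

lemma val_bar:
  assumes "s \<in> letters"
  shows "val (map_sum bar\<^sub>G bar\<^sub>H s) = inv\<^bsub>W\<^esub> (val s)"
proof (rule W.inv_equality[symmetric])
  show closed: "val s \<in> carrier W" "val (map_sum bar\<^sub>G bar\<^sub>H s) \<in> carrier W"
    using assms G.bar_closed H.bar_closed by (auto intro!: funcset_mem[OF val_closed])
  show "val (map_sum bar\<^sub>G bar\<^sub>H s) \<otimes>\<^bsub>W\<^esub> val s = \<one>\<^bsub>W\<^esub>"
  proof (cases s)
    case (Inl g)
    then have "g \<in> \<Gamma>" using assms by auto
    then show ?thesis
      using Inl G.\<rho>_bar[of g] G.\<rho>_closed[of "[g]"]
      unfolding Inl map_sum.simps val.simps base_mult[OF H.one_closed]
      by (auto simp: at_coset_def gen_wreath_def intro!: restrict_ext)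
  next
    case (Inr a)
    then have "a \<in> \<Sigma>" using assms by auto
    then show ?thesis
      using Inr H.\<rho>_bar[of a] H.\<rho>_closed[of "[a]"] top_mult[of "inv\<^bsub>H\<^esub> \<rho>\<^sub>H [a]" "\<lambda>C. \<one>\<^bsub>G\<^esub>" "\<rho>\<^sub>H [a]"]
      by (simp add: gen_wreath_def)
  qed
qed

text \<open>Conjugating by elements of \<open>H\<close> moves the copy of \<open>G\<close> at the trivial coset to any other coset, and
  a family with finite support is a product of families supported at one coset.\<close>

lemma val_generates:
  assumes "x \<in> carrier W"
  shows "\<exists>w\<in>lists letters. word_value W val w = x"
proof -
  define L where "L = word_value W val ` lists letters"
  have mult: "x \<otimes>\<^bsub>W\<^esub> y \<in> L" if xy: "x \<in> L" "y \<in> L" for x y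
  proof -
    obtain u v where "u \<in> lists letters" "v \<in> lists letters" "x = word_value W val u" "y = word_value W val v"
      using xy unfolding L_def by blast
    then show ?thesis
      unfolding L_def using W.word_value_append[OF val_closed, of u v]
      by (intro image_eqI[of _ _ "u @ v"]) auto
  qed
  have top: "(\<one>\<^bsub>wreath_base G H H'\<^esub>, h) \<in> L" if h: "h \<in> carrier H" for h
  proof -
    obtain w where "w \<in> lists \<Sigma>" "\<rho>\<^sub>H w = h" using H.\<rho>_surj[OF h] by blast
    then show ?thesis
      unfolding L_def using word_value_moves[of w] by (intro image_eqI[of _ _ "map Inr w"]) auto
  qed
  have single: "(at_coset C x, \<one>\<^bsub>H\<^esub>) \<in> L" if C: "C \<in> cosets" and x: "x \<in> carrier G" for C x
  proof -
    obtain k where k: "k \<in> carrier H" "C = H' #>\<^bsub>H\<^esub> k"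
      using C by (auto simp: RCOSETS_def)
    obtain w where w: "w \<in> lists \<Gamma>" "\<rho>\<^sub>G w = x" using G.\<rho>_surj[OF x] by blast
    have "visible step H' D (map Inl w) = (if D = H' then w else [])" for D
      by (induction w) auto
    moreover have "moves (map Inl w) = ([] :: 's list)" by (induction w) auto
    moreover have "map Inl w \<in> lists letters" using w by auto
    ultimately have "((\<lambda>D\<in>cosets. if D = H' then x else \<one>\<^bsub>G\<^esub>), \<one>\<^bsub>H\<^esub>) \<in> L"
      unfolding L_def using w
      by (intro image_eqI[of _ _ "map Inl w"]) (auto simp: word_value_wreath intro!: restrict_ext)
    then have "((\<lambda>D\<in>cosets. if D = H' then x else \<one>\<^bsub>G\<^esub>), \<one>\<^bsub>H\<^esub>) \<otimes>\<^bsub>W\<^esub> (\<one>\<^bsub>wreath_base G H H'\<^esub>, k) \<in> L"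
      using top[OF k(1)] by (rule mult)
    then have "((\<lambda>D\<in>cosets. if D = H' then x else \<one>\<^bsub>G\<^esub>), k) \<in> L"
    proof (rule back_subst[of "\<lambda>x. x \<in> L"])
      show "((\<lambda>D\<in>cosets. if D = H' then x else \<one>\<^bsub>G\<^esub>), \<one>\<^bsub>H\<^esub>) \<otimes>\<^bsub>W\<^esub> (\<one>\<^bsub>wreath_base G H H'\<^esub>, k) =
          ((\<lambda>D\<in>cosets. if D = H' then x else \<one>\<^bsub>G\<^esub>), k)"
        unfolding base_mult[OF k(1)] using x by (auto intro!: restrict_ext)
    qed
    then have "(\<one>\<^bsub>wreath_base G H H'\<^esub>, inv\<^bsub>H\<^esub> k) \<otimes>\<^bsub>W\<^esub>
        ((\<lambda>D\<in>cosets. if D = H' then x else \<one>\<^bsub>G\<^esub>), k) \<in> L"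
      using top[of "inv\<^bsub>H\<^esub> k"] k(1) by (intro mult) auto
    moreover have "D #>\<^bsub>H\<^esub> inv\<^bsub>H\<^esub> k = H' \<longleftrightarrow> D = C" if D: "D \<in> cosets" for D
    proof
      assume "D #>\<^bsub>H\<^esub> inv\<^bsub>H\<^esub> k = H'"
      then have "D #>\<^bsub>H\<^esub> inv\<^bsub>H\<^esub> k #>\<^bsub>H\<^esub> k = C" using k by simp
      then show "D = C" using D k by (simp add: coset_assoc coset_one)
    next
      assume "D = C"
      then show "D #>\<^bsub>H\<^esub> inv\<^bsub>H\<^esub> k = H'" using k H'_coset by (simp add: coset_assoc coset_one)
    qed
    ultimately show ?thesis
      using k x top_mult[of "inv\<^bsub>H\<^esub> k" "\<lambda>D. if D = H' then x else \<one>\<^bsub>G\<^esub>" k]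
      by (simp add: at_coset_def cong: restrict_cong)
  qed
  have base: "(f, \<one>\<^bsub>H\<^esub>) \<in> L"
    if "finite F" "F \<subseteq> cosets" "f \<in> carrier (wreath_base G H H')" "{C \<in> cosets. f C \<noteq> \<one>\<^bsub>G\<^esub>} \<subseteq> F" for F f
    using that
  proof (induction F arbitrary: f rule: finite_induct)
    case empty
    then have f: "f = \<one>\<^bsub>wreath_base G H H'\<^esub>"
      by (auto simp: carrier_base PiE_iff extensional_def restrict_def)
    show ?case unfolding f by (rule top[OF H.one_closed])
  next
    case (insert C F)
    define f' where "f' = (\<lambda>D\<in>cosets. if D = C then \<one>\<^bsub>G\<^esub> else f D)"
    have C: "C \<in> cosets" using insert.prems by simp
    have f: "f \<in> cosets \<rightarrow>\<^sub>E carrier G" "finite {C \<in> cosets. f C \<noteq> \<one>\<^bsub>G\<^esub>}"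
      using insert.prems by (auto simp: carrier_base)
    have "f' \<in> carrier (wreath_base G H H')"
      using f by (auto simp: carrier_base f'_def PiE_iff elim!: rev_finite_subset)
    moreover have "{D \<in> cosets. f' D \<noteq> \<one>\<^bsub>G\<^esub>} \<subseteq> F"
      using insert.prems by (auto simp: f'_def)
    ultimately have "(f', \<one>\<^bsub>H\<^esub>) \<in> L" using insert by auto
    moreover have "(at_coset C (f C), \<one>\<^bsub>H\<^esub>) \<in> L" using C f by (intro single) auto
    ultimately have "(at_coset C (f C), \<one>\<^bsub>H\<^esub>) \<otimes>\<^bsub>W\<^esub> (f', \<one>\<^bsub>H\<^esub>) \<in> L" by (intro mult)
    moreover have "(\<lambda>D\<in>cosets. at_coset C (f C) D \<otimes>\<^bsub>G\<^esub> f' D) = f"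
    proof
      show "(\<lambda>D\<in>cosets. at_coset C (f C) D \<otimes>\<^bsub>G\<^esub> f' D) D = f D" for D
        using f(1) by (cases "D \<in> cosets") (auto simp: at_coset_def f'_def PiE_iff extensional_def)
    qed
    ultimately show ?case by (simp add: base_mult)
  qed
  obtain f h where x: "x = (f, h)" "f \<in> carrier (wreath_base G H H')" "h \<in> carrier H"
    using assms by (auto simp: gen_wreath_def)
  have f: "f \<in> cosets \<rightarrow>\<^sub>E carrier G" "finite {C \<in> cosets. f C \<noteq> \<one>\<^bsub>G\<^esub>}"
    using x by (auto simp: carrier_base)
  have "(f, \<one>\<^bsub>H\<^esub>) \<otimes>\<^bsub>W\<^esub> (\<one>\<^bsub>wreath_base G H H'\<^esub>, h) \<in> L"
    using base[OF f(2) _ x(2)] top[OF x(3)] by (intro mult) auto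
  moreover have "(\<lambda>C\<in>cosets. f C \<otimes>\<^bsub>G\<^esub> \<one>\<^bsub>wreath_base G H H'\<^esub> C) = f"
  proof
    show "(\<lambda>C\<in>cosets. f C \<otimes>\<^bsub>G\<^esub> \<one>\<^bsub>wreath_base G H H'\<^esub> C) D = f D" for D
      using f(1) by (cases "D \<in> cosets") (auto simp: PiE_iff extensional_def)
  qed
  ultimately have "x \<in> L" using x by (simp add: base_mult)
  then show ?thesis by (auto simp: L_def)
qed

lemma word_value_in_subgroup_iff:
  assumes "w \<in> lists letters"
  shows "word_value W val w \<in> gen_wreath_subgroup G G' H H' \<longleftrightarrow>
    \<rho>\<^sub>G (visible step H' H' w) \<in> G' \<and> \<rho>\<^sub>H (moves w) \<in> H'"
proof -
  have "(\<lambda>C\<in>cosets. \<rho>\<^sub>G (visible step H' C w)) \<in> carrier (wreath_base G H H')"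
    using W.word_value_closed[OF val_closed assms] unfolding word_value_wreath[OF assms]
    by (simp add: gen_wreath_def)
  then show ?thesis
    unfolding word_value_wreath[OF assms] gen_wreath_subgroup_def using H'_coset by simp
qed

end

theorem theorem4:
  fixes G :: "('g, 'm) monoid_scheme" and H :: "('h, 'n) monoid_scheme"
    and G\<^sub>s :: "'g set" and H\<^sub>s :: "'h set"
  assumes "group G" and "finitely_generated G"
    and "group H" and "finitely_generated H"
    and "context_free_subgroup G G\<^sub>s"
    and "context_free_subgroup H H\<^sub>s"
  shows "context_free_subgroup (gen_wreath G H H\<^sub>s) (gen_wreath_subgroup G G\<^sub>s H H\<^sub>s)"
proof -
  obtain \<Gamma> :: "nat set" and bar\<^sub>G \<rho>\<^sub>G and Q :: "(nat \<times> (nat + nat) list) set" and T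
    where G: "group_presentation G \<Gamma> bar\<^sub>G \<rho>\<^sub>G" "subgroup G\<^sub>s G" "finite Q"
      and Q: "\<And>w. yields Q [Inl T] w \<longleftrightarrow> w \<in> lists \<Gamma> \<and> \<rho>\<^sub>G w \<in> G\<^sub>s"
    using assms(5) by (rule context_free_subgroup_presentation) blast
  obtain \<Sigma> :: "nat set" and bar\<^sub>H \<rho>\<^sub>H and R :: "(nat \<times> (nat + nat) list) set" and S
    where H: "group_presentation H \<Sigma> bar\<^sub>H \<rho>\<^sub>H" "subgroup H\<^sub>s H" "finite R"
      and R: "\<And>w. yields R [Inl S] w \<longleftrightarrow> w \<in> lists \<Sigma> \<and> \<rho>\<^sub>H w \<in> H\<^sub>s"
    using assms(6) by (rule context_free_subgroup_presentation) blast
  interpret wreath_presentation G \<Gamma> bar\<^sub>G \<rho>\<^sub>G H \<Sigma> bar\<^sub>H \<rho>\<^sub>H H\<^sub>s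
    using G(1) H(1,2) by (simp add: wreath_presentation_def wreath_presentation_axioms_def)
  interpret A: context_free_action \<Sigma> bar\<^sub>H cosets step H\<^sub>s R S
    by (rule schreier_context_free_action(1)) (fact H R)+
  interpret A: wreath_words \<Sigma> bar\<^sub>H cosets step H\<^sub>s R S \<Gamma> Q T
    by unfold_locales (auto simp: Q G.finite_alphabet G(3))
  show ?thesis
  proof (rule W.context_free_subgroupI)
    show "subgroup (gen_wreath_subgroup G G\<^sub>s H H\<^sub>s) W"
      using assms(1,3) G(2) H(2) by (rule subgroup_gen_wreath)
    show "symmetric_alphabet letters (map_sum bar\<^sub>G bar\<^sub>H)"
      using G.alphabet H.alphabet by (auto simp: symmetric_alphabet_def)
    show "val \<in> letters \<rightarrow> carrier W" by (rule val_closed)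
    show "val (map_sum bar\<^sub>G bar\<^sub>H s) = inv\<^bsub>W\<^esub> val s" if "s \<in> letters" for s
      using that by (rule val_bar)
    show "\<exists>w\<in>lists letters. word_value W val w = x" if "x \<in> carrier W" for x
      using that by (rule val_generates)
    show "finite A.rules" by (rule A.finite_rules)
    fix w :: "(nat + nat) list"
    show "yields A.rules [Inl Start] w \<longleftrightarrow>
        w \<in> lists letters \<and> word_value W val w \<in> gen_wreath_subgroup G G\<^sub>s H H\<^sub>s"
    proof (cases "w \<in> lists letters")
      case True
      have "foldl step H\<^sub>s (moves w) = H\<^sub>s \<longleftrightarrow> \<rho>\<^sub>H (moves w) \<in> H\<^sub>s"
        using A.loops[of "moves w"] R[of "moves w"] moves_lists[OF True] by simp
      then show ?thesis
        using True visible_lists[OF True, of step H\<^sub>s H\<^sub>s]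
        by (auto simp: A.yields_wreath_iff Q word_value_in_subgroup_iff)
    qed (simp add: A.yields_wreath_iff)
  qed
qed

end
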